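(* Let $w$ be an edge path in an associahedron that starts at a vertex $D$, and let $\Sigma(w)$ be its signed graph. Then the following hold. (1) The path $w$ is valid with a sign assignment for $D$ if and only if the sign assignment is compatible with $\Sigma(w)$. (2) If $\Sigma(w)$ is balanced, the number of sign assignments on $D$ for which $w$ is valid is $2^p$, where $p$ is the number of components of $\Sigma(w)$ regarded as a graph on the internal vertices of $D$. (3) If $\Sigma(w)$ is balanced, the number of valid colorings of the pair $(D,Dw)$ that are compatible with $\Sigma(w)$, modulo permutations of the colors, is $2^{p-1}$ with $p$ as in (2).
   Context: **Trees.** $\mathcal T$ is the infinite binary tree whose vertices are a root $*$ and all finite words over $\{0,1\}$ (including the empty word $\emptyset$). The only child of $*$ is $\emptyset$; the word $u$ has left child $u0$ and right child $u1$. A finite binary tree is a finite subtree of $\mathcal T$ containing $*$ and $\emptyset$, closed under taking prefixes, in which $u0$ is a vertex iff $u1$ is. Leaves are the vertices without children, numbered from left to right; internal vertices are the words in the tree that are not leaves. **Rotations.** For $u\in\{0,1\}^*$, the rotation $\lceil u\rfloor$ is the permutation of the vertices of $\mathcal T$ (acting on the right) given by $u00w\mapsto u0w$, $u01w\mapsto u10w$, $u1w\mapsto u11w$ for all $w\in\{0,1\}^*$, $u0\mapsto u$, $u\mapsto u1$, and fixing every other vertex. The symbol $\overline u$ is formal and $\lceil\overline u\rfloor=\lceil u\rfloor^{-1}$. The pivot vertices of $\lceil u\rfloor$ are $u$ and $u0$; the pivot vertices of $\lceil\overline u\rfloor$ are $u$ and $u1$. If both pivot vertices of a rotation $\lceil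 v\rfloor$ ($v=u$ or $v=\overline u$) are internal vertices of a finite binary tree $T$, then $\lceil v\rfloor$ applies to $T$, and $T\lceil v\rfloor$ is the finite binary tree whose vertex set is the image of that of $T$. **Associahedron.** The vertices of the $d$-dimensional associahedron $A_d$ are the finite binary trees with $d+2$ leaves; two are joined by an edge iff one is obtained from the other by a rotation. An edge path starting at $D$ is a word $w=\lceil v_1\rfloor\cdots\lceil v_k\rfloor$ (each $v_i$ of the form $u$ or $\overline u$) such that each $\lceil v_i\rfloor$ applies to $D\lceil v_1\rfloor\cdots\lceil v_{i-1}\rfloor$; its endpoint is $Dw$. **Sign assignments and validity.** A sign assignment on $T$ is a function $\sigma$ from the internal vertices of $T$ to $\{+,-\}$. A rotation $\lceil v\rfloor$ that applies to $T$ is valid for $(T,\sigma)$ if $\sigma$ gives equal signs to its two pivot vertices; the result is $T\lceil v\rfloor$ with the sign assignment $\rho$ where $\rho(x\lceil v\rfloor)=-\sigma(x)$ if $x$ is a pivot vertex of $\lceil v\rfloor$ and $\rho(x\lceil v\rfloor)=\sigma(x)$ for every other internal vertex $x$. A path $w$ starting at $D$ is valid for a sign assignment on $D$ if its rotations, performed in succession, are each valid for the signed tree to which they are applied. **The signed graph $\Sigma(w)$.** Put $p_0=\mathrm{id}$ and $p_i=\lceil v_1\rfloor\cdots\lceil v_i\rfloor$ (permutations act on the right, composed left to right). $\Sigma_0$ has no edges. $\Sigma_i$ is obtained from $\Sigma_{i-1}$ by adding one edge $e_i$ (parallel edges allowed) joining $s=(x)p_{i-1}^{-1}$ and $t=(y)p_{i-1}^{-1}$,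 where $x,y$ are the pivot vertices of $\lceil v_i\rfloor$; $e_i$ is positive iff the sum of the degrees of $s$ and $t$ in $\Sigma_{i-1}$ is even. $\Sigma(w)=\Sigma_k$. All endpoints of its edges are internal vertices of $D$, so it may be regarded as a graph on the internal vertices of $D$. A signed graph is balanced if every closed walk traverses an even number of negative edges. **Colorings.** Colors are elements of $\mathbb Z_2\times\mathbb Z_2$, coded $0=(0,0)$, $1=(0,1)$, $2=(1,0)$, $3=(1,1)$, and added in this group. A color vector for a tree with $n$ leaves is $\mathbf c=(c_1,\dots,c_n)$; it determines the unique edge coloring in which the edge at the $i$-th leaf has color $c_i$ and the three edges at each internal vertex sum to $0$. It is valid for the tree if this is a proper edge coloring using only colors $1,2,3$. It is a (valid) coloring of a pair $(D,R)$ of trees with the same number of leaves if it is valid for both. A valid $\mathbf c$ gives a derived sign assignment on a tree: an internal vertex is $+$ if the colors of its (parent edge, left child edge, right child edge) form a cyclic permutation of $(1,2,3)$, and $-$ otherwise. The group $S_3$ acts by permuting the colors $1,2,3$. **Compatibility.** A sign assignment on the internal vertices of $D$ is compatible with $\Sigma(w)$ if every edge of $\Sigma(w)$ is positive if and only if it joins two vertices with the same sign. A coloring of $(D,Dw)$ is compatible with $\Sigma(w)$ if its derived sign assignment on $D$ is. *)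

theory Defs
  imports Main "HOL-Library.Sublist" "HOL-Library.FuncSet" "HOL-Library.Z2"
    "HOL-Library.Product_Plus" "HOL-Combinatorics.Permutations"
begin

section \<open>Finite binary trees\<close>

text \<open>The letters 0 (left) and 1 (right) are \<^term>\<open>False\<close> and \<^term>\<open>True\<close>.\<close>

type_synonym word = "bool list"

datatype vertex = Root | Word word

inductive is_child :: "vertex \<Rightarrow> vertex \<Rightarrow> bool" where
  "is_child Root (Word [])"
| "is_child (Word u) (Word (u @ [b]))"

fun parent :: "vertex \<Rightarrow> vertex" where
  "parent Root = Root"
| "parent (Word u) = (if u = [] then Root else Word (butlast u))"

definition finite_binary_tree :: "vertex set \<Rightarrow> bool" where
  "finite_binary_tree T \<longleftrightarrow>
     finite T \<and> Root \<in> T \<and> Word [] \<in> T \<and>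
     (\<forall>u v. Word v \<in> T \<longrightarrow> prefix u v \<longrightarrow> Word u \<in> T) \<and>
     (\<forall>u. Word (u @ [False]) \<in> T \<longleftrightarrow> Word (u @ [True]) \<in> T)"

definition leaves :: "vertex set \<Rightarrow> vertex set" where
  "leaves T = {x \<in> T. \<not> (\<exists>y \<in> T. is_child x y)}"

definition internal :: "vertex set \<Rightarrow> vertex set" where
  "internal T = {x \<in> T. x \<noteq> Root \<and> x \<notin> leaves T}"

inductive left_of :: "vertex \<Rightarrow> vertex \<Rightarrow> bool" where
  "left_of (Word (p @ False # u)) (Word (p @ True # v))"

text \<open>Numbering of the leaves from left to right, starting with 0 (to match list indexing).\<close>

definition leaf_index :: "vertex set \<Rightarrow> vertex \<Rightarrow> nat" where
  "leaf_index T x = card {y \<in> leaves T. left_of y x}"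


section \<open>Rotations and edge paths in the associahedron\<close>

text \<open>
  The rotation at the empty word; the rotation at \<open>u\<close> does the same below \<open>u\<close>.
\<close>

fun rot_suffix :: "word \<Rightarrow> word" where
  "rot_suffix [] = [True]"
| "rot_suffix [False] = []"
| "rot_suffix (False # False # w) = False # w"
| "rot_suffix (False # True # w) = True # False # w"
| "rot_suffix (True # w) = True # True # w"

fun rot :: "word \<Rightarrow> vertex \<Rightarrow> vertex" where
  "rot u Root = Root"
| "rot u (Word x) =
     Word (if prefix u x then u @ rot_suffix (drop (length u) x) else x)"

lemma rot_suffix_image:
  "rot_suffix x = rot_suffix y \<Longrightarrow> x = y" "\<exists>x. rot_suffix x = z"
proof -
  define g :: "word \<Rightarrow> word" where
    "g = (\<lambda>y. case y of [] \<Rightarrow> [False] | False # v \<Rightarrow> False # False # v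
       | [True] \<Rightarrow> [] | True # False # v \<Rightarrow> False # True # v | True # True # v \<Rightarrow> True # v)"
  have "g (rot_suffix x) = x" for x
    by (cases x rule: rot_suffix.cases) (simp_all add: g_def)
  then show "rot_suffix x = rot_suffix y \<Longrightarrow> x = y" by metis
  have "rot_suffix (g z) = z" by (auto simp: g_def split: list.splits bool.splits)
  then show "\<exists>x. rot_suffix x = z" by blast
qed

lemma bij_rot: "bij (rot u)"
proof (rule bijI)
  show "inj (rot u)"
  proof (rule injI)
    fix x y assume "rot u x = rot u y"
    then show "x = y"
      by (cases x; cases y)
        (auto simp: prefix_def dest: rot_suffix_image(1) split: if_splits)
  qed
  have "\<exists>x. rot u x = y" for y
  proof (cases y)
    case Root
    then show ?thesis by (intro exI[of _ Root]) simp
  next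
    case (Word z)
    show ?thesis
    proof (cases "prefix u z")
      case True
      then obtain v where v: "z = u @ v" by (auto simp: prefix_def)
      obtain x where "rot_suffix x = v" using rot_suffix_image(2) by blast
      then show ?thesis using Word v by (intro exI[of _ "Word (u @ x)"]) simp
    next
      case False
      then show ?thesis using Word by (intro exI[of _ "Word z"]) simp
    qed
  qed
  then show "surj (rot u)" by (metis surjI)
qed

datatype rotation = Rot word | Bar word

text \<open>Permutations are functions; composing left to right, as for a right action, is therefore
  written in the opposite order with \<open>\<circ>\<close>.\<close>

fun perm :: "rotation \<Rightarrow> vertex \<Rightarrow> vertex" where
  "perm (Rot u) = rot u"
| "perm (Bar u) = inv (rot u)"

fun pivot1 :: "rotation \<Rightarrow> vertex" where
  "pivot1 (Rot u) = Word u"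
| "pivot1 (Bar u) = Word u"

fun pivot2 :: "rotation \<Rightarrow> vertex" where
  "pivot2 (Rot u) = Word (u @ [False])"
| "pivot2 (Bar u) = Word (u @ [True])"

definition pivots :: "rotation \<Rightarrow> vertex set" where
  "pivots v = {pivot1 v, pivot2 v}"

definition applies :: "rotation \<Rightarrow> vertex set \<Rightarrow> bool" where
  "applies v T \<longleftrightarrow> pivots v \<subseteq> internal T"

definition rotate_tree :: "vertex set \<Rightarrow> rotation \<Rightarrow> vertex set" where
  "rotate_tree T v = perm v ` T"

definition associahedron_vertices :: "nat \<Rightarrow> vertex set set" where
  "associahedron_vertices d = {T. finite_binary_tree T \<and> card (leaves T) = d + 2}"

primrec edge_path :: "vertex set \<Rightarrow> rotation list \<Rightarrow> bool" where
  "edge_path T [] \<longleftrightarrow> True"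
| "edge_path T (v # w) \<longleftrightarrow> applies v T \<and> edge_path (rotate_tree T v) w"

definition path_end :: "vertex set \<Rightarrow> rotation list \<Rightarrow> vertex set" where
  "path_end D w = foldl rotate_tree D w"

definition path_perm :: "rotation list \<Rightarrow> vertex \<Rightarrow> vertex" where
  "path_perm w = foldl (\<lambda>p v. perm v \<circ> p) id w"


section \<open>Sign assignments and validity\<close>

datatype sign = Plus | Minus

fun flip :: "sign \<Rightarrow> sign" where
  "flip Plus = Minus"
| "flip Minus = Plus"

definition sign_assignments :: "vertex set \<Rightarrow> (vertex \<Rightarrow> sign) set" where
  "sign_assignments T = internal T \<rightarrow>\<^sub>E UNIV"

definition valid_rotation :: "vertex set \<Rightarrow> (vertex \<Rightarrow> sign) \<Rightarrow> rotation \<Rightarrow> bool" where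
  "valid_rotation T \<sigma> v \<longleftrightarrow> applies v T \<and> \<sigma> (pivot1 v) = \<sigma> (pivot2 v)"

definition rotate_signs ::
    "vertex set \<Rightarrow> (vertex \<Rightarrow> sign) \<Rightarrow> rotation \<Rightarrow> vertex \<Rightarrow> sign" where
  "rotate_signs T \<sigma> v =
     (\<lambda>y \<in> internal (rotate_tree T v).
        let x = inv (perm v) y in if x \<in> pivots v then flip (\<sigma> x) else \<sigma> x)"

primrec valid_path :: "vertex set \<Rightarrow> (vertex \<Rightarrow> sign) \<Rightarrow> rotation list \<Rightarrow> bool" where
  "valid_path T \<sigma> [] \<longleftrightarrow> True"
| "valid_path T \<sigma> (v # w) \<longleftrightarrow>
     valid_rotation T \<sigma> v \<and> valid_path (rotate_tree T v) (rotate_signs T \<sigma> v) w"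


section \<open>Signed graphs\<close>

text \<open>A signed multigraph is the list of its edges, each given by its two ends and its sign;
  the order of the two ends is immaterial.\<close>

type_synonym 'a signed_edge = "'a \<times> 'a \<times> sign"

definition degree :: "'a signed_edge list \<Rightarrow> 'a \<Rightarrow> nat" where
  "degree G x =
     length (filter (\<lambda>(s, t, b). s = x) G) + length (filter (\<lambda>(s, t, b). t = x) G)"

definition joins :: "'a signed_edge \<Rightarrow> 'a \<Rightarrow> 'a \<Rightarrow> bool" where
  "joins e x y \<longleftrightarrow> (case e of (s, t, b) \<Rightarrow> (s = x \<and> t = y) \<or> (s = y \<and> t = x))"

definition negative :: "'a signed_edge \<Rightarrow> bool" where
  "negative e \<longleftrightarrow> snd (snd e) = Minus"

inductive walk :: "'a signed_edge list \<Rightarrow> 'a \<Rightarrow> 'a signed_edge list \<Rightarrow> 'a \<Rightarrow> bool" for G where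
  "walk G x [] x"
| "e \<in> set G \<Longrightarrow> joins e x y \<Longrightarrow> walk G y es z \<Longrightarrow> walk G x (e # es) z"

definition balanced :: "'a signed_edge list \<Rightarrow> bool" where
  "balanced G \<longleftrightarrow> (\<forall>x es. walk G x es x \<longrightarrow> even (length (filter negative es)))"

text \<open>The connected components of \<open>G\<close> as a graph with vertex set \<open>V\<close>; isolated vertices
  are components.\<close>

definition components :: "'a set \<Rightarrow> 'a signed_edge list \<Rightarrow> 'a set set" where
  "components V G = V // {(x, y). x \<in> V \<and> y \<in> V \<and> (\<exists>es. walk G x es y)}"

primrec Sigma_upto :: "rotation list \<Rightarrow> nat \<Rightarrow> vertex signed_edge list" where
  "Sigma_upto w 0 = []"
| "Sigma_upto w (Suc i) =
     (let G = Sigma_upto w i;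
          q = inv (path_perm (take i w));
          s = q (pivot1 (w ! i));
          t = q (pivot2 (w ! i))
      in G @ [(s, t, if even (degree G s + degree G t) then Plus else Minus)])"

definition Sigma_graph :: "rotation list \<Rightarrow> vertex signed_edge list" where
  "Sigma_graph w = Sigma_upto w (length w)"

definition compatible :: "(vertex \<Rightarrow> sign) \<Rightarrow> vertex signed_edge list \<Rightarrow> bool" where
  "compatible \<sigma> G \<longleftrightarrow> (\<forall>(s, t, b) \<in> set G. b = Plus \<longleftrightarrow> \<sigma> s = \<sigma> t)"


section \<open>Colorings\<close>

type_synonym color = "bit \<times> bit"

definition color1 :: color where "color1 = (0, 1)"
definition color2 :: color where "color2 = (1, 0)"
definition color3 :: color where "color3 = (1, 1)"

text \<open>An edge of a tree is represented by its lower endpoint, that is, the vertex \<open>x\<close> stands for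
  the edge joining \<open>x\<close> to \<open>parent x\<close>.\<close>

definition tree_edges :: "vertex set \<Rightarrow> vertex set" where
  "tree_edges T = T - {Root}"

definition adjacent_edges :: "vertex \<Rightarrow> vertex \<Rightarrow> bool" where
  "adjacent_edges x y \<longleftrightarrow> x \<noteq> y \<and> {x, parent x} \<inter> {y, parent y} \<noteq> {}"

definition edge_coloring :: "vertex set \<Rightarrow> color list \<Rightarrow> vertex \<Rightarrow> color" where
  "edge_coloring T c =
     (THE f. f \<in> tree_edges T \<rightarrow>\<^sub>E UNIV \<and>
        (\<forall>x \<in> leaves T. f x = c ! leaf_index T x) \<and>
        (\<forall>u. Word u \<in> internal T \<longrightarrow>
           f (Word u) + f (Word (u @ [False])) + f (Word (u @ [True])) = 0))"

definition proper_coloring :: "vertex set \<Rightarrow> (vertex \<Rightarrow> color) \<Rightarrow> bool" where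
  "proper_coloring T f \<longleftrightarrow>
     (\<forall>x \<in> tree_edges T. \<forall>y \<in> tree_edges T. adjacent_edges x y \<longrightarrow> f x \<noteq> f y)"

definition valid_coloring :: "vertex set \<Rightarrow> color list \<Rightarrow> bool" where
  "valid_coloring T c \<longleftrightarrow>
     length c = card (leaves T) \<and>
     proper_coloring T (edge_coloring T c) \<and>
     edge_coloring T c ` tree_edges T \<subseteq> {color1, color2, color3}"

definition valid_pair_coloring :: "vertex set \<Rightarrow> vertex set \<Rightarrow> color list \<Rightarrow> bool" where
  "valid_pair_coloring D R c \<longleftrightarrow> valid_coloring D c \<and> valid_coloring R c"

definition derived_signs :: "vertex set \<Rightarrow> color list \<Rightarrow> vertex \<Rightarrow> sign" where
  "derived_signs T c =
     (\<lambda>x \<in> internal T. case x of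
        Word u \<Rightarrow>
          let f = edge_coloring T c in
          if (f (Word u), f (Word (u @ [False])), f (Word (u @ [True]))) \<in>
               {(color1, color2, color3), (color2, color3, color1), (color3, color1, color2)}
          then Plus else Minus
      | Root \<Rightarrow> undefined)"

definition compatible_colorings :: "vertex set \<Rightarrow> rotation list \<Rightarrow> color list set" where
  "compatible_colorings D w =
     {c. valid_pair_coloring D (path_end D w) c \<and>
         compatible (derived_signs D c) (Sigma_graph w)}"

text \<open>The orbit relation of the action of \<open>S\<^sub>3\<close> on color vectors.\<close>

definition color_permutation_rel :: "(color list \<times> color list) set" where
  "color_permutation_rel =
     {(c, c'). \<exists>\<pi>. \<pi> permutes {color1, color2, color3} \<and> c' = map \<pi> c}"

end

theory Submission
  imports Defs
begin

text \<open>
  A rotation along the path compares the current signs of its two pivot vertices. Pulled back to the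
  initial tree, the pivot vertices become the ends \<open>s\<close> and \<open>t\<close> of the edge that the rotation adds to
  the signed graph. Each earlier rotation with \<open>s\<close> as a pivot has reversed the sign of \<open>s\<close>, so the
  current sign is the initial one reversed as often as the degree of \<open>s\<close> says
  (\<open>path_signs_degree\<close>). Hence the rotation is valid iff the initial signs of \<open>s\<close> and \<open>t\<close> differ by the
  parity of the sum of the degrees, that is, iff the new edge is satisfied
  (\<open>valid_path_iff_compatible\<close>).

  In a balanced graph a sign at one vertex of a component spreads consistently along walks to the
  whole component and determines all signs there, which gives a free binary choice for each
  component (\<open>card_compatible_assignments\<close>).

  For colorings, a valid coloring of a tree amounts to a color at the root edge together with an
  arbitrary sign assignment, because a color and a sign determine the colors of the two child edges
  (\<open>bij_betw_derived_signs\<close>). If the two pivot vertices of a rotation have equal derived signs, the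
  coloring stays valid after the rotation and its derived signs change exactly as sign assignments
  do (\<open>valid_coloring_rotate\<close>). So a coloring of the initial tree that is compatible with the graph
  is automatically valid for the final tree. Modulo permutations of the colors one may normalize the
  edges at the vertex below the root to the colors 1, 2, 3 in this order, which leaves the compatible
  sign assignments with a plus sign at that vertex (\<open>card_color_orbits\<close>). Since compatibility is
  preserved when all signs are reversed, these are half of all compatible assignments
  (\<open>card_compatible_with_Plus\<close>).
\<close>

section \<open>Sign assignments compatible with a balanced signed graph\<close>

lemma flip_flip [simp]: "flip (flip s) = s"
  by (cases s) simp_all

lemma flip_eq_iff [simp]: "flip s = flip t \<longleftrightarrow> s = t" "flip s \<noteq> s" "s \<noteq> flip s"
  by (cases s; cases t; simp)+

lemma neq_iff_flip: "s \<noteq> t \<longleftrightarrow> s = flip t"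
  by (cases s; cases t) simp_all

lemma funpow_flip: "(flip ^^ n) s = (if even n then s else flip s)"
  by (induction n) simp_all

lemma UNIV_sign: "(UNIV :: sign set) = {Plus, Minus}"
  using sign.exhaust by auto

lemma joins_commute: "joins e x y \<longleftrightarrow> joins e y x"
  by (auto simp: joins_def split: prod.splits)

lemma walk_append: "walk G x es y \<Longrightarrow> walk G y fs z \<Longrightarrow> walk G x (es @ fs) z"
  by (induction rule: walk.induct) (auto intro: walk.intros)

lemma walk_rev: "walk G x es y \<Longrightarrow> walk G y (rev es) x"
proof (induction rule: walk.induct)
  case (2 e x y es z)
  have "walk G y [e] x"
    using walk.intros(2)[OF 2(1) _ walk.intros(1), of y x] 2(2) joins_commute by metis
  then show ?case using walk_append[OF 2(4)] by simp
qed (auto intro: walk.intros)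

lemma compatible_iff_if_same_equalities:
  assumes "\<And>s t b. (s, t, b) \<in> set G \<Longrightarrow> \<sigma> s = \<sigma> t \<longleftrightarrow> \<tau> s = \<tau> t"
  shows "compatible \<sigma> G \<longleftrightarrow> compatible \<tau> G"
  unfolding compatible_def using assms by (intro ball_cong refl) auto

lemma compatible_edge:
  assumes "compatible \<sigma> G" "e \<in> set G" "joins e x y"
  shows "\<sigma> x = \<sigma> y \<longleftrightarrow> \<not> negative e"
  using assms by (cases e; cases "snd (snd e)")
    (fastforce simp: compatible_def joins_def negative_def)+

lemma compatible_walk:
  assumes "walk G x es y" and "compatible \<sigma> G"
  shows "\<sigma> y = (flip ^^ length (filter negative es)) (\<sigma> x)"
  using assms
proof (induction rule: walk.induct)
  case (2 e x y es z)
  have "\<sigma> y = (if negative e then flip (\<sigma> x) else \<sigma> x)"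
    using compatible_edge[OF 2(5) 2(1) 2(2)] neq_iff_flip by metis
  then show ?case using 2 by (simp add: funpow_flip)
qed simp

lemma balanced_walk_parity:
  assumes "balanced G" "walk G x es y" "walk G x fs y"
  shows "even (length (filter negative es)) \<longleftrightarrow> even (length (filter negative fs))"
proof -
  have "walk G x (es @ rev fs) x"
    using assms walk_append walk_rev by metis
  then have "even (length (filter negative (es @ rev fs)))"
    using assms(1) unfolding balanced_def by blast
  then show ?thesis by (simp add: rev_filter[symmetric])
qed

text \<open>A compatible assignment is determined by its values on one representative of each component,
  because a walk transports a sign up to the parity of its negative edges; balance makes this
  transport independent of the walk, so that the values on the representatives are free.\<close>

lemma card_compatible_assignments:
  fixes V :: "vertex set"
  assumes fin: "finite V" and G: "\<forall>(s, t, b) \<in> set G. s \<in> V \<and> t \<in> V" and bal: "balanced G"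
  shows "card {\<sigma> \<in> V \<rightarrow>\<^sub>E UNIV. compatible \<sigma> G} = 2 ^ card (components V G)"
proof -
  define r where "r = {(x, y). x \<in> V \<and> y \<in> V \<and> (\<exists>es. walk G x es y)}"
  define rep where "rep C = (SOME x. x \<in> C)" for C :: "vertex set"
  define K where "K = components V G"
  have K: "K = V // r" by (simp add: K_def components_def r_def)
  have equiv: "equiv V r"
  proof (rule equivI)
    show "r \<subseteq> V \<times> V" by (auto simp: r_def)
    show "refl_on V r" by (auto simp: refl_on_def r_def intro: walk.intros)
    show "sym r" by (auto simp: sym_def r_def intro: walk_rev)
    show "trans r" by (auto simp: trans_def r_def intro: walk_append)
  qed
  have finK: "finite K" unfolding K using fin equiv by (auto simp: equiv_def intro: finite_quotient)
  have rep: "rep C \<in> C" if "C \<in> K" for C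
    using that in_quotient_imp_non_empty[OF equiv] unfolding K rep_def by (metis all_not_in_conv someI)
  define cl where "cl x = r `` {x}" for x
  have cl: "cl x \<in> K" "(rep (cl x), x) \<in> r" if "x \<in> V" for x
  proof -
    show "cl x \<in> K" using that by (auto simp: K cl_def intro: quotientI)
    from rep[OF this] have "(x, rep (cl x)) \<in> r" by (simp add: cl_def)
    then show "(rep (cl x), x) \<in> r" using equiv by (auto simp: equiv_def dest: symD)
  qed
  have cl_rep: "cl (rep C) = C" "rep C \<in> V" if "C \<in> K" for C
  proof -
    show "rep C \<in> V" using rep[OF that] that in_quotient_imp_subset[OF equiv] unfolding K by blast
    then show "cl (rep C) = C" using rep[OF that] that equiv unfolding K cl_def
      by (metis Image_singleton_iff equiv_class_eq quotientE)
  qed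
  define F where "F \<sigma> = (\<lambda>C\<in>K. \<sigma> (rep C))" for \<sigma> :: "vertex \<Rightarrow> sign"
  have "bij_betw F {\<sigma> \<in> V \<rightarrow>\<^sub>E UNIV. compatible \<sigma> G} (K \<rightarrow>\<^sub>E UNIV)"
  proof (rule bij_betw_imageI)
    show "inj_on F {\<sigma> \<in> V \<rightarrow>\<^sub>E UNIV. compatible \<sigma> G}"
    proof (rule inj_onI, clarify)
      fix \<sigma> \<tau> assume *: "\<sigma> \<in> V \<rightarrow>\<^sub>E UNIV" "\<tau> \<in> V \<rightarrow>\<^sub>E UNIV" "compatible \<sigma> G" "compatible \<tau> G" "F \<sigma> = F \<tau>"
      show "\<sigma> = \<tau>"
      proof (rule PiE_ext[OF *(1,2)])
        fix x assume x: "x \<in> V"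
        obtain es where es: "walk G (rep (cl x)) es x" using cl(2)[OF x] by (auto simp: r_def)
        have "\<sigma> (rep (cl x)) = \<tau> (rep (cl x))"
          using fun_cong[OF *(5), of "cl x"] cl(1)[OF x] by (simp add: F_def)
        then show "\<sigma> x = \<tau> x" using compatible_walk[OF es *(3)] compatible_walk[OF es *(4)] by simp
      qed
    qed
    show "F ` {\<sigma> \<in> V \<rightarrow>\<^sub>E UNIV. compatible \<sigma> G} = K \<rightarrow>\<^sub>E UNIV"
    proof
      show "K \<rightarrow>\<^sub>E UNIV \<subseteq> F ` {\<sigma> \<in> V \<rightarrow>\<^sub>E UNIV. compatible \<sigma> G}"
      proof
        fix \<tau> :: "vertex set \<Rightarrow> sign" assume \<tau>: "\<tau> \<in> K \<rightarrow>\<^sub>E UNIV"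
        define route where "route x = (SOME es. walk G (rep (cl x)) es x)" for x
        have route: "walk G (rep (cl x)) (route x) x" if "x \<in> V" for x
          using cl(2)[OF that] unfolding route_def by (auto simp: r_def intro: someI)
        define \<sigma> where
          "\<sigma> = (\<lambda>x\<in>V. (flip ^^ length (filter negative (route x))) (\<tau> (cl x)))"
        have "compatible \<sigma> G" unfolding compatible_def
        proof clarify
          fix s t b assume e: "(s, t, b) \<in> set G"
          then have V: "s \<in> V" "t \<in> V" using G by auto
          have st: "walk G s [(s, t, b)] t" using e by (auto simp: joins_def intro: walk.intros)
          then have same: "cl s = cl t"
            unfolding cl_def using V by (intro equiv_class_eq[OF equiv]) (auto simp: r_def)
          have "even (length (filter negative (route s @ [(s, t, b)])))
              \<longleftrightarrow> even (length (filter negative (route t)))"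
            using balanced_walk_parity[OF bal walk_append[OF route[OF V(1)] st]] route[OF V(2)] same
            by simp
          then show "(b = Plus) = (\<sigma> s = \<sigma> t)"
            using V same by (cases b) (auto simp: \<sigma>_def funpow_flip negative_def split: if_splits)
        qed
        moreover have "F \<sigma> = \<tau>"
        proof (rule PiE_ext[OF _ \<tau>])
          show "F \<sigma> \<in> K \<rightarrow>\<^sub>E UNIV" by (auto simp: F_def)
          fix C assume C: "C \<in> K"
          have "walk G (rep C) (route (rep C)) (rep C)"
            using route[OF cl_rep(2)[OF C]] cl_rep(1)[OF C] by simp
          then have "even (length (filter negative (route (rep C))))"
            using bal unfolding balanced_def by blast
          then show "F \<sigma> C = \<tau> C" using C cl_rep[OF C] by (simp add: F_def \<sigma>_def funpow_flip)
        qed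
        moreover have "\<sigma> \<in> V \<rightarrow>\<^sub>E UNIV" by (auto simp: \<sigma>_def)
        ultimately show "\<tau> \<in> F ` {\<sigma> \<in> V \<rightarrow>\<^sub>E UNIV. compatible \<sigma> G}" by blast
      qed
    qed (auto simp: F_def)
  qed
  then have "card {\<sigma> \<in> V \<rightarrow>\<^sub>E UNIV. compatible \<sigma> G} = card (K \<rightarrow>\<^sub>E (UNIV :: sign set))"
    by (rule bij_betw_same_card)
  also have "\<dots> = 2 ^ card K" using finK by (simp add: card_PiE UNIV_sign numeral_2_eq_2)
  finally show ?thesis by (simp add: K_def)
qed

text \<open>Reversing all signs preserves compatibility, so that exactly half of the compatible
  assignments have a prescribed sign at a given vertex.\<close>

lemma card_compatible_with_Plus:
  assumes fin: "finite V" and G: "\<forall>(s, t, b) \<in> set G. s \<in> V \<and> t \<in> V" and x: "x \<in> V"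
  shows "2 * card {\<sigma> \<in> V \<rightarrow>\<^sub>E UNIV. compatible \<sigma> G \<and> \<sigma> x = Plus} =
    card {\<sigma> \<in> V \<rightarrow>\<^sub>E UNIV. compatible \<sigma> G}"
proof -
  define P where "P s = {\<sigma> \<in> V \<rightarrow>\<^sub>E UNIV. compatible \<sigma> G \<and> \<sigma> x = s}" for s
  define N where "N \<sigma> = (\<lambda>y\<in>V. flip (\<sigma> y))" for \<sigma> :: "vertex \<Rightarrow> sign"
  have N_compatible: "compatible (N \<sigma>) G \<longleftrightarrow> compatible \<sigma> G" for \<sigma>
  proof (rule compatible_iff_if_same_equalities)
    fix s t b assume "(s, t, b) \<in> set G"
    then have "s \<in> V" "t \<in> V" using G by auto
    then show "N \<sigma> s = N \<sigma> t \<longleftrightarrow> \<sigma> s = \<sigma> t" by (simp add: N_def)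
  qed
  have NP: "N \<sigma> \<in> P (flip s)" if "\<sigma> \<in> P s" for \<sigma> s
    using that N_compatible x by (simp add: P_def) (simp add: N_def)
  have NN: "N (N \<sigma>) = \<sigma>" if "\<sigma> \<in> P s" for \<sigma> s
    using that unfolding P_def N_def by (auto simp: fun_eq_iff PiE_def extensional_def)
  have "bij_betw N (P Plus) (P Minus)"
    using NP[of _ Plus] NP[of _ Minus] NN by (intro bij_betw_byWitness[of _ N]) auto
  then have eq: "card (P Minus) = card (P Plus)" by (simp add: bij_betw_same_card)
  have "finite (V \<rightarrow>\<^sub>E (UNIV :: sign set))" using fin by (simp add: finite_PiE UNIV_sign)
  then have "finite (P s)" for s by (rule finite_subset[rotated]) (auto simp: P_def)
  moreover have "P Plus \<inter> P Minus = {}" by (auto simp: P_def)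
  moreover have "{\<sigma> \<in> V \<rightarrow>\<^sub>E UNIV. compatible \<sigma> G} = P Plus \<union> P Minus"
    using sign.exhaust by (auto simp: P_def)
  ultimately have "card {\<sigma> \<in> V \<rightarrow>\<^sub>E UNIV. compatible \<sigma> G} = 2 * card (P Plus)"
    using eq by (simp add: card_Un_disjoint)
  then show ?thesis by (simp add: P_def)
qed

section \<open>Words, left-to-right order and rotations\<close>

fun precedes :: "word \<Rightarrow> word \<Rightarrow> bool" where
  "precedes (a # x) (b # y) \<longleftrightarrow> (if a = b then precedes x y else b)"
| "precedes _ _ \<longleftrightarrow> False"

lemma precedes_append [simp]: "precedes (p @ x) (p @ y) \<longleftrightarrow> precedes x y"
  by (induction p) simp_all

lemma left_of_iff: "left_of x y \<longleftrightarrow> (\<exists>a b. x = Word a \<and> y = Word b \<and> precedes a b)"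
proof -
  have "\<exists>p u v. a = p @ False # u \<and> b = p @ True # v" if "precedes a b" for a b
    using that
  proof (induction a b rule: precedes.induct)
    case (1 a x b y)
    show ?case
    proof (cases "a = b")
      case True
      then obtain p u v where "x = p @ False # u" "y = p @ True # v" using 1 by auto
      then have "a # x = (a # p) @ False # u" "b # y = (a # p) @ True # v" using True by simp_all
      then show ?thesis by blast
    next
      case False
      then have "a # x = [] @ False # x" "b # y = [] @ True # y" using 1 by auto
      then show ?thesis by blast
    qed
  qed simp_all
  then show ?thesis by (fastforce simp: left_of.simps)
qed

lemma precedes_trans: "precedes x y \<Longrightarrow> precedes y z \<Longrightarrow> precedes x z"
proof (induction x y arbitrary: z rule: precedes.induct)
  case (1 a x b y)
  then show ?case by (cases z) (auto split: if_splits)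
qed simp_all

lemma precedes_irrefl [simp]: "\<not> precedes x x"
  by (induction x) simp_all

lemma precedes_total: "precedes x y \<or> precedes y x \<or> prefix x y \<or> prefix y x"
  by (induction x y rule: precedes.induct) auto

text \<open>The rotation, read off by recursion along the common prefix with its base word.\<close>

fun rotate_word :: "word \<Rightarrow> word \<Rightarrow> word" where
  "rotate_word [] x = rot_suffix x"
| "rotate_word (b # u) [] = []"
| "rotate_word (b # u) (a # x) = a # (if a = b then rotate_word u x else x)"

lemma rot_Word [simp]: "rot u (Word x) = Word (rotate_word u x)"
  by (induction u x rule: rotate_word.induct) auto

declare rot.simps(2) [simp del]

lemma rotate_word_append [simp]: "rotate_word u (u @ x) = u @ rot_suffix x"
  by (induction u) simp_all

lemma rotate_word_base [simp]: "rotate_word u u = u @ [True]"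
  using rotate_word_append[of u "[]"] by simp

lemma rotate_word_outside: "\<not> prefix u x \<Longrightarrow> rotate_word u x = x"
  by (induction u x rule: rotate_word.induct) auto

text \<open>Only the two pivot vertices, which are internal, change their place in the left-to-right order.
  Leaves therefore keep their numbers, and a color vector can be read on both trees.\<close>

lemma precedes_rotate_word:
  assumes "x \<noteq> u" "x \<noteq> u @ [False]" "y \<noteq> u" "y \<noteq> u @ [False]"
  shows "precedes (rotate_word u x) (rotate_word u y) \<longleftrightarrow> precedes x y"
  using assms
proof (induction u arbitrary: x y)
  case Nil
  then show ?case
    by (cases x rule: rot_suffix.cases; cases y rule: rot_suffix.cases) simp_all
next
  case (Cons b u)
  then show ?case by (cases x; cases y) auto
qed

section \<open>Finite binary trees and their leaves\<close>

lemma finite_binary_tree_iff: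
  "finite_binary_tree T \<longleftrightarrow> finite T \<and> Root \<in> T \<and> Word [] \<in> T \<and>
     (\<forall>u b. Word (u @ [b]) \<in> T \<longrightarrow> Word u \<in> T) \<and>
     (\<forall>u. Word (u @ [False]) \<in> T \<longleftrightarrow> Word (u @ [True]) \<in> T)"
proof -
  have "Word v \<in> T \<Longrightarrow> prefix u v \<Longrightarrow> Word u \<in> T"
    if "\<forall>u b. Word (u @ [b]) \<in> T \<longrightarrow> Word u \<in> T" for u v
    using that by (induction v rule: rev_induct) auto
  then show ?thesis
    unfolding finite_binary_tree_def by (metis prefixI)
qed

lemma tree_prefix:
  "finite_binary_tree T \<Longrightarrow> Word (u @ v) \<in> T \<Longrightarrow> Word u \<in> T"
  unfolding finite_binary_tree_def by (metis prefixI)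

lemma tree_sibling:
  "finite_binary_tree T \<Longrightarrow> Word (u @ [b]) \<in> T \<Longrightarrow> Word (u @ [c]) \<in> T"
  unfolding finite_binary_tree_def by (cases b; cases c) auto

lemma internal_iff:
  assumes "finite_binary_tree T"
  shows "x \<in> internal T \<longleftrightarrow> (\<exists>u. x = Word u \<and> Word (u @ [b]) \<in> T)"
proof (cases x)
  case Root
  then show ?thesis by (simp add: internal_def)
next
  case (Word u)
  have "Word u \<in> internal T \<longleftrightarrow> Word u \<in> T \<and> (\<exists>c. Word (u @ [c]) \<in> T)"
    by (auto simp: internal_def leaves_def is_child.simps)
  also have "\<dots> \<longleftrightarrow> Word (u @ [b]) \<in> T"
    using tree_sibling[OF assms, of u _ b] tree_prefix[OF assms, of u] by blast
  finally show ?thesis using Word by simp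
qed

lemma Word_internal_iff:
  "finite_binary_tree T \<Longrightarrow> Word u \<in> internal T \<longleftrightarrow> Word (u @ [b]) \<in> T"
  by (simp add: internal_iff[of T _ b])

lemma leaves_eq: "finite_binary_tree T \<Longrightarrow> leaves T = T - {Root} - internal T"
  unfolding internal_def leaves_def finite_binary_tree_def by (auto intro: is_child.intros)

lemma leaf_iff:
  "finite_binary_tree T \<Longrightarrow>
     x \<in> leaves T \<longleftrightarrow> (\<exists>u. x = Word u \<and> Word u \<in> T \<and> Word (u @ [b]) \<notin> T)"
  by (cases x) (auto simp: leaves_eq internal_iff[of T _ b])

lemma leaf_obtain_word:
  assumes "finite_binary_tree T" "x \<in> leaves T"
  obtains u where "x = Word u" "Word u \<in> T"
  using assms(2) that unfolding leaf_iff[OF assms(1), of x False] by blast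

lemma finite_leaves: "finite_binary_tree T \<Longrightarrow> finite (leaves T)"
  and finite_internal: "finite_binary_tree T \<Longrightarrow> finite (internal T)"
  unfolding finite_binary_tree_def leaves_def internal_def by simp_all

lemma leaf_no_extension:
  assumes "finite_binary_tree T" "Word u \<in> leaves T" "prefix u v" "Word v \<in> T"
  shows "v = u"
proof -
  obtain x where v: "v = u @ x" using assms(3) by (auto simp: prefix_def)
  have "x = []"
  proof (rule ccontr)
    assume "x \<noteq> []"
    then obtain b y where "x = b # y" by (cases x) auto
    then have "Word (u @ [b]) \<in> T" using tree_prefix[OF assms(1), of "u @ [b]" y] assms(4) v by simp
    then show False using leaf_iff[OF assms(1), of _ b] assms(2) by simp
  qed
  then show ?thesis using v by simp
qed

lemma leaves_left_of_total:
  assumes "finite_binary_tree T" "x \<in> leaves T" "y \<in> leaves T" "x \<noteq> y"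
  shows "left_of x y \<or> left_of y x"
proof -
  obtain u v where uv: "x = Word u" "y = Word v" "Word u \<in> T" "Word v \<in> T"
    using leaf_obtain_word[OF assms(1)] assms(2,3) by metis
  have "\<not> prefix u v" "\<not> prefix v u"
    using leaf_no_extension[OF assms(1), of u v] leaf_no_extension[OF assms(1), of v u] uv assms
    by auto
  then show ?thesis using precedes_total[of u v] uv by (auto simp: left_of_iff)
qed

lemma bij_betw_leaf_index:
  assumes T: "finite_binary_tree T"
  shows "bij_betw (leaf_index T) (leaves T) {..<card (leaves T)}"
proof -
  have "leaf_index T x < leaf_index T y"
    if "x \<in> leaves T" "left_of x y" for x y
  proof -
    have "x \<in> {z \<in> leaves T. left_of z y}" "x \<notin> {z \<in> leaves T. left_of z x}"
      using that by (auto simp: left_of_iff)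
    moreover have "{z \<in> leaves T. left_of z x} \<subseteq> {z \<in> leaves T. left_of z y}"
      using that by (auto simp: left_of_iff intro: precedes_trans)
    ultimately show ?thesis
      unfolding leaf_index_def using finite_leaves[OF T] by (intro psubset_card_mono) auto
  qed
  then have inj: "inj_on (leaf_index T) (leaves T)"
    using leaves_left_of_total[OF T] by (intro inj_onI) (metis less_irrefl)
  have "leaf_index T x < card (leaves T)" if "x \<in> leaves T" for x
  proof -
    have "{y \<in> leaves T. left_of y x} \<subseteq> leaves T - {x}"
      by (auto simp: left_of_iff)
    then have "leaf_index T x \<le> card (leaves T - {x})"
      unfolding leaf_index_def using finite_leaves[OF T] by (intro card_mono) auto
    also have "\<dots> < card (leaves T)"
      using finite_leaves[OF T] that by (rule card_Diff1_less)
    finally show ?thesis .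
  qed
  then have "leaf_index T ` leaves T \<subseteq> {..<card (leaves T)}" by auto
  then have "leaf_index T ` leaves T = {..<card (leaves T)}"
    by (rule card_subset_eq[rotated]) (simp_all add: card_image[OF inj])
  then show ?thesis using inj by (simp add: bij_betw_def)
qed

lemma leaf_index_less:
  "finite_binary_tree T \<Longrightarrow> x \<in> leaves T \<Longrightarrow> leaf_index T x < card (leaves T)"
  using bij_betw_leaf_index by (auto dest!: bij_betwE)

lemma tree_bottom_up_induct [consumes 2, case_names leaf node]:
  assumes T: "finite_binary_tree T" and "Word u \<in> T"
    and leaf: "\<And>u. Word u \<in> leaves T \<Longrightarrow> P u"
    and node: "\<And>u. Word u \<in> internal T \<Longrightarrow> P (u @ [False]) \<Longrightarrow> P (u @ [True]) \<Longrightarrow> P u"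
  shows "P u"
proof -
  have "finite (Word -` T)"
    using T unfolding finite_binary_tree_def by (intro finite_vimageI) (auto intro: inj_onI)
  then obtain N where N: "\<And>u. Word u \<in> T \<Longrightarrow> length u < N"
    using finite_nat_set_iff_bounded[of "length ` (Word -` T)"] by auto
  show ?thesis using \<open>Word u \<in> T\<close>
  proof (induction "N - length u" arbitrary: u rule: less_induct)
    case less
    show ?case
    proof (cases "Word u \<in> internal T")
      case True
      then have "Word (u @ [b]) \<in> T" for b using Word_internal_iff[OF T] by blast
      then have "P (u @ [b])" for b using less(1)[of "u @ [b]"] N[of "u @ [b]"] by simp
      then show ?thesis using node True by blast
    next
      case False
      then show ?thesis using leaf less(2) leaves_eq[OF T] by simp
    qed
  qed
qed

lemma top_vertex_internal:
  assumes T: "finite_binary_tree T" and "card (leaves T) \<ge> 2"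
  shows "Word [] \<in> internal T"
proof (rule ccontr)
  assume "Word [] \<notin> internal T"
  then have "Word [] \<in> leaves T" using T by (auto simp: leaves_eq finite_binary_tree_def)
  then have "x = Word []" if "x \<in> leaves T" for x
    using leaf_no_extension[OF T] leaf_obtain_word[OF T that] by (metis Nil_prefix)
  then have "leaves T \<subseteq> {Word []}" by blast
  then have "card (leaves T) \<le> 1" using card_mono[of "{Word []}" "leaves T"] by simp
  then show False using assms(2) by simp
qed

section \<open>A rotation between two trees\<close>

lemma rotated_mem:
  "Word (rotate_word u x) \<in> rot u ` T \<longleftrightarrow> Word x \<in> T"
  using inj_image_mem_iff[OF bij_is_inj[OF bij_rot], of u "Word x" T] by simp

lemma rotated_mem_simps:
  "\<not> prefix u y \<Longrightarrow> Word y \<in> rot u ` T \<longleftrightarrow> Word y \<in> T"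
  "Word u \<in> rot u ` T \<longleftrightarrow> Word (u @ [False]) \<in> T"
  "Word (u @ [True]) \<in> rot u ` T \<longleftrightarrow> Word u \<in> T"
  "Word (u @ False # v) \<in> rot u ` T \<longleftrightarrow> Word (u @ False # False # v) \<in> T"
  "Word (u @ True # False # v) \<in> rot u ` T \<longleftrightarrow> Word (u @ False # True # v) \<in> T"
  "Word (u @ True # True # v) \<in> rot u ` T \<longleftrightarrow> Word (u @ True # v) \<in> T"
  using rotated_mem[of u y T] rotated_mem[of u "u @ [False]" T] rotated_mem[of u u T]
    rotated_mem[of u "u @ False # False # v" T] rotated_mem[of u "u @ False # True # v" T]
    rotated_mem[of u "u @ True # v" T]
  by (simp_all add: rotate_word_outside)

lemma word_cases_left:
  fixes u y :: word
  obtains "\<not> prefix u y" | "y = u" | "y = u @ [False]" | v where "y = u @ False # False # v"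
    | v where "y = u @ False # True # v" | v where "y = u @ True # v"
proof (cases "prefix u y")
  case True
  then obtain z where "y = u @ z" by (auto simp: prefix_def)
  then show ?thesis using that by (cases z rule: rot_suffix.cases) auto
qed

lemma word_cases_right:
  fixes u y :: word
  obtains "\<not> prefix u y" | "y = u" | "y = u @ [True]" | v where "y = u @ False # v"
    | v where "y = u @ True # False # v" | v where "y = u @ True # True # v"
proof (cases "prefix u y")
  case True
  then obtain z where z: "y = u @ z" by (auto simp: prefix_def)
  consider "z = []" | "z = [True]" | v where "z = False # v" | v where "z = True # False # v"
    | v where "z = True # True # v"
    by (metis (full_types) list.exhaust)
  then show ?thesis using that z by cases auto
qed (use that in blast)

lemma finite_binary_tree_rotated:
  assumes L: "finite_binary_tree L" and u: "Word (u @ [False, False]) \<in> L"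
  shows "finite_binary_tree (rot u ` L)" (is "finite_binary_tree ?R")
  unfolding finite_binary_tree_iff
proof (intro conjI allI impI)
  note pre = tree_prefix[OF L] and sib = tree_sibling[OF L]
  have u': "Word u \<in> L" "Word (u @ [False]) \<in> L" "Word (u @ [True]) \<in> L" "Word (u @ [False, True]) \<in> L"
    using pre[of u] pre[of "u @ [False]" "[False]"] sib[of "u @ [False]" False True] u sib[of u False True]
    by simp_all
  show "finite ?R" using L by (simp add: finite_binary_tree_def)
  show "Root \<in> ?R" using L by (auto simp: finite_binary_tree_def image_iff intro: bexI[of _ Root])
  show "Word [] \<in> ?R"
  proof (cases "u = []")
    case True
    then show ?thesis using u' rotated_mem_simps(2)[of "[]" L] by simp
  next
    case False
    then show ?thesis using L rotated_mem_simps(1)[of u "[]" L] by (simp add: finite_binary_tree_def)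
  qed
  show "Word y \<in> ?R" if "Word (y @ [b]) \<in> ?R" for y b
  proof (cases u y rule: word_cases_right)
    case 1
    then show ?thesis using that u' pre[of y "[b]"]
      by (cases "prefix u (y @ [b])") (auto simp: rotated_mem_simps)
  next
    case (4 v)
    then show ?thesis using that pre[of "u @ False # False # v" "[b]"] by (simp add: rotated_mem_simps)
  next
    case (5 v)
    then show ?thesis using that pre[of "u @ False # True # v" "[b]"] by (simp add: rotated_mem_simps)
  next
    case (6 v)
    then show ?thesis using that pre[of "u @ True # v" "[b]"] by (simp add: rotated_mem_simps)
  qed (use u' in \<open>simp_all add: rotated_mem_simps\<close>)
  show "Word (y @ [False]) \<in> ?R \<longleftrightarrow> Word (y @ [True]) \<in> ?R" for y
  proof (cases u y rule: word_cases_right)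
    case 1
    have "Word (y @ [b]) \<in> ?R \<longleftrightarrow> Word (y @ [b]) \<in> L" for b
      using 1 u' by (cases "prefix u (y @ [b])") (auto simp: rotated_mem_simps)
    then show ?thesis using sib by blast
  next
    case (4 v)
    then show ?thesis using sib[of "u @ False # False # v"] by (auto simp: rotated_mem_simps)
  next
    case (5 v)
    then show ?thesis using sib[of "u @ False # True # v"] by (auto simp: rotated_mem_simps)
  next
    case (6 v)
    then show ?thesis using sib[of "u @ True # v"] by (auto simp: rotated_mem_simps)
  qed (use u u' in \<open>simp_all add: rotated_mem_simps\<close>)
qed

lemma finite_binary_tree_unrotated:
  assumes R: "finite_binary_tree (rot u ` L)" and u: "Word (u @ [True, True]) \<in> rot u ` L"
  shows "finite_binary_tree L"
  unfolding finite_binary_tree_iff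
proof (intro conjI allI impI)
  let ?R = "rot u ` L"
  note pre = tree_prefix[OF R] and sib = tree_sibling[OF R]
  have uR: "Word u \<in> ?R" "Word (u @ [False]) \<in> ?R" "Word (u @ [True]) \<in> ?R"
    "Word (u @ [True, False]) \<in> ?R"
    using pre[of u] pre[of "u @ [True]" "[True]"] sib[of "u @ [True]" True False] u sib[of u True False]
    by simp_all
  then have u': "Word u \<in> L" "Word (u @ [False]) \<in> L" "Word (u @ [True]) \<in> L"
      "Word (u @ [False, False]) \<in> L" "Word (u @ [False, True]) \<in> L"
    using u by (simp_all add: rotated_mem_simps)
  show "finite L" using R bij_is_inj[OF bij_rot]
    by (auto simp: finite_binary_tree_def intro: finite_imageD inj_on_subset)
  have "rot u x \<noteq> Root" if "x \<noteq> Root" for x using that by (cases x) auto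
  then show "Root \<in> L" using R by (metis finite_binary_tree_def imageE)
  show "Word [] \<in> L"
  proof (cases "u = []")
    case False
    then show ?thesis using R rotated_mem_simps(1)[of u "[]" L] by (simp add: finite_binary_tree_def)
  qed (use u' in simp)
  show "Word y \<in> L" if "Word (y @ [b]) \<in> L" for y b
  proof (cases u y rule: word_cases_left)
    case 1
    then show ?thesis using that uR pre[of y "[b]"]
      by (cases "prefix u (y @ [b])") (auto simp: rotated_mem_simps)
  next
    case (4 v)
    then show ?thesis using that pre[of "u @ False # v" "[b]"] by (simp add: rotated_mem_simps)
  next
    case (5 v)
    then show ?thesis using that pre[of "u @ True # False # v" "[b]"] by (simp add: rotated_mem_simps)
  next
    case (6 v)
    then show ?thesis using that pre[of "u @ True # True # v" "[b]"] by (simp add: rotated_mem_simps)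
  qed (use u' in simp_all)
  show "Word (y @ [False]) \<in> L \<longleftrightarrow> Word (y @ [True]) \<in> L" for y
  proof (cases u y rule: word_cases_left)
    case 1
    have "Word (y @ [b]) \<in> ?R \<longleftrightarrow> Word (y @ [b]) \<in> L" for b
      using 1 u' by (cases "prefix u (y @ [b])") (auto simp: rotated_mem_simps)
    then show ?thesis using sib by blast
  next
    case (4 v)
    then show ?thesis using sib[of "u @ False # v"] by (auto simp: rotated_mem_simps)
  next
    case (5 v)
    then show ?thesis using sib[of "u @ True # False # v"] by (auto simp: rotated_mem_simps)
  next
    case (6 v)
    then show ?thesis using sib[of "u @ True # True # v"] by (auto simp: rotated_mem_simps)
  qed (use u' in simp_all)
qed

text \<open>A rotation and its inverse are treated at once, as the two directions of passage between the
  tree \<open>L\<close> that contains the left comb at \<open>u\<close> and the tree \<open>R\<close> that contains the right comb.\<close>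

locale rotation_pair =
  fixes u :: word and L R :: "vertex set"
  assumes L: "finite_binary_tree L" and R: "finite_binary_tree R" and R_eq: "R = rot u ` L"
    and left_comb: "Word (u @ [False, False]) \<in> L"
begin

lemmas mem_R = rotated_mem_simps[where u = u and T = L, folded R_eq]

lemma left_comb_mem:
  "Word u \<in> L" "Word (u @ [False]) \<in> L" "Word (u @ [True]) \<in> L" "Word (u @ [False, True]) \<in> L"
  using tree_prefix[OF L, of u] tree_prefix[OF L, of "u @ [False]" "[False]"] left_comb
    tree_sibling[OF L, of u False True] tree_sibling[OF L, of "u @ [False]" False True]
  by simp_all

lemma right_comb_mem: "Word u \<in> R" "Word (u @ [True]) \<in> R"
  using left_comb_mem by (simp_all add: mem_R)

lemma internal_R_iff: "rot u x \<in> internal R \<longleftrightarrow> x \<in> internal L"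
proof (cases x)
  case Root
  then show ?thesis by (simp add: internal_def)
next
  case (Word z)
  have eq: "Word (rotate_word u z @ [False]) \<in> R \<longleftrightarrow> Word (z @ [False]) \<in> L"
  proof (cases u z rule: word_cases_left)
    case 1
    show ?thesis
    proof (cases "prefix u (z @ [False])")
      case True
      then have "z @ [False] = u" using 1 by auto
      then show ?thesis using 1 left_comb_mem(1) right_comb_mem(1)
        by (simp add: rotate_word_outside)
    qed (use 1 in \<open>simp add: rotate_word_outside mem_R\<close>)
  qed (use left_comb left_comb_mem in \<open>simp_all add: mem_R\<close>)
  show ?thesis
    using eq Word by (simp add: Word_internal_iff[OF L, of _ False] Word_internal_iff[OF R, of _ False])
qed

lemma internal_R: "internal R = rot u ` internal L"
  using internal_R_iff bij_rot[of u] by (auto simp: image_iff) (metis bij_pointE)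

lemma leaves_R: "leaves R = rot u ` leaves L"
proof -
  have "R - {Root} = rot u ` (L - {Root})"
    using image_set_diff[OF bij_is_inj[OF bij_rot], of u L "{Root}"] R_eq by simp
  then show ?thesis
    using image_set_diff[OF bij_is_inj[OF bij_rot], of u "L - {Root}" "internal L"]
    by (simp add: leaves_eq[OF L] leaves_eq[OF R] internal_R)
qed

lemma card_leaves_R: "card (leaves R) = card (leaves L)"
  unfolding leaves_R by (intro card_image inj_on_subset[OF bij_is_inj[OF bij_rot]]) simp

lemma leaf_index_R:
  assumes "x \<in> leaves L"
  shows "leaf_index R (rot u x) = leaf_index L x"
proof -
  have np: "y \<noteq> Word u" "y \<noteq> Word (u @ [False])" if "y \<in> leaves L" for y
    using that left_comb left_comb_mem leaf_iff[OF L, of y False] by auto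
  have "left_of (rot u y) (rot u x) \<longleftrightarrow> left_of y x" if y: "y \<in> leaves L" for y
  proof -
    obtain a where a: "y = Word a" "Word a \<in> L" using leaf_obtain_word[OF L y] .
    obtain b where b: "x = Word b" "Word b \<in> L" using leaf_obtain_word[OF L assms] .
    show ?thesis using a b np[OF y] np[OF assms] precedes_rotate_word[of a u b]
      by (simp add: left_of_iff)
  qed
  then have "{y \<in> leaves R. left_of y (rot u x)} = rot u ` {y \<in> leaves L. left_of y x}"
    unfolding leaves_R by auto
  then show ?thesis unfolding leaf_index_def
    by (simp add: card_image inj_on_subset[OF bij_is_inj[OF bij_rot]])
qed

end

lemma rotation_pair_Rot:
  assumes "finite_binary_tree T" "applies (Rot u) T"
  shows "rotation_pair u T (rotate_tree T (Rot u))"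
proof -
  have *: "Word (u @ [False, False]) \<in> T"
    using assms(2) Word_internal_iff[OF assms(1), of "u @ [False]" False]
    by (simp add: applies_def pivots_def)
  show ?thesis
    using assms(1) * finite_binary_tree_rotated[OF assms(1) *]
    by unfold_locales (simp_all add: rotate_tree_def)
qed

lemma rotation_pair_Bar:
  assumes "finite_binary_tree T" "applies (Bar u) T"
  shows "rotation_pair u (rotate_tree T (Bar u)) T"
proof -
  define L where "L = rotate_tree T (Bar u)"
  have T: "T = rot u ` L"
    by (simp add: L_def rotate_tree_def image_comp surj_f_inv_f[OF bij_is_surj[OF bij_rot]])
  have *: "Word (u @ [True, True]) \<in> T" "Word (u @ [False]) \<in> T"
    using assms(2) Word_internal_iff[OF assms(1), of "u @ [True]" True]
      Word_internal_iff[OF assms(1), of u False]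
    by (simp_all add: applies_def pivots_def)
  have "finite_binary_tree L"
    using finite_binary_tree_unrotated assms(1) * T by metis
  then have "rotation_pair u L T"
    using assms(1) T * rotated_mem_simps(4)[of u "[]" L] by unfold_locales simp_all
  then show ?thesis by (simp add: L_def)
qed

section \<open>Colors and edge colorings\<close>

lemma color_cases:
  fixes c :: color
  obtains "c = 0" | "c = color1" | "c = color2" | "c = color3"
proof (cases c)
  case (Pair a b)
  then show ?thesis using that
    by (cases a; cases b) (simp_all add: color1_def color2_def color3_def zero_prod_def)
qed

lemma color_distinct [simp]:
  "color1 \<noteq> 0" "color2 \<noteq> 0" "color3 \<noteq> 0" "0 \<noteq> color1" "0 \<noteq> color2" "0 \<noteq> color3"
  "color1 \<noteq> color2" "color1 \<noteq> color3" "color2 \<noteq> color3"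
  "color2 \<noteq> color1" "color3 \<noteq> color1" "color3 \<noteq> color2"
  by (simp_all add: color1_def color2_def color3_def zero_prod_def)

lemma color_add_table [simp]:
  "color1 + color2 = color3" "color1 + color3 = color2" "color2 + color3 = color1"
  "color2 + color1 = color3" "color3 + color1 = color2" "color3 + color2 = color1"
  by (simp_all add: color1_def color2_def color3_def zero_prod_def)

lemma color_add_self [simp]: "c + c = (0 :: color)"
  by (cases c) (simp add: zero_prod_def)

lemma color_add_eq_0_iff: "a + b = (0 :: color) \<longleftrightarrow> a = b"
  by (cases a rule: color_cases; cases b rule: color_cases) simp_all

lemma color_nonzero_iff: "c \<noteq> 0 \<longleftrightarrow> c \<in> {color1, color2, color3}"
  by (cases c rule: color_cases) simp_all

lemma color_sum_0_iff: "a + b + c = 0 \<longleftrightarrow> a = b + (c :: color)"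
  by (cases a rule: color_cases; cases b rule: color_cases; cases c rule: color_cases) simp_all

definition vertex_sign :: "color \<Rightarrow> color \<Rightarrow> color \<Rightarrow> sign" where
  "vertex_sign a b c =
     (if (a, b, c) \<in> {(color1, color2, color3), (color2, color3, color1), (color3, color1, color2)}
      then Plus else Minus)"

text \<open>In the group of colors \<open>a + b + c = 0\<close> means \<open>a = b + c\<close>, which lets colors be computed upwards
  from the leaves.\<close>

definition extends_coloring :: "vertex set \<Rightarrow> color list \<Rightarrow> (vertex \<Rightarrow> color) \<Rightarrow> bool" where
  "extends_coloring T c f \<longleftrightarrow>
     (\<forall>x \<in> leaves T. f x = c ! leaf_index T x) \<and>
     (\<forall>u. Word u \<in> internal T \<longrightarrow> f (Word u) = f (Word (u @ [False])) + f (Word (u @ [True])))"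

lemma extends_coloring_unique:
  assumes "finite_binary_tree T" "extends_coloring T c f" "extends_coloring T c g" "Word u \<in> T"
  shows "f (Word u) = g (Word u)"
  using assms(1,4,2,3) unfolding extends_coloring_def
  by (induction rule: tree_bottom_up_induct) auto

text \<open>Reading \<open>f u = f u0 + f u1\<close> downwards to the leaves shows what the color of an edge must be: the
  sum of the colors of the leaves below it.\<close>

lemma extends_coloring_exists:
  assumes T: "finite_binary_tree T"
  shows "\<exists>f. extends_coloring T c f"
proof -
  define B where "B u = {Word v |v. Word v \<in> leaves T \<and> prefix u v}" for u
  define f where
    "f x = (case x of Root \<Rightarrow> 0 | Word u \<Rightarrow> \<Sum>y \<in> B u. c ! leaf_index T y)" for x
  have "f x = c ! leaf_index T x" if x: "x \<in> leaves T" for x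
  proof -
    obtain u where u: "x = Word u" "Word u \<in> T" using leaf_obtain_word[OF T x] .
    have "B u = {x}"
      using x u(1) leaf_no_extension[OF T] leaves_eq[OF T] by (auto simp: B_def)
    then show ?thesis by (simp add: f_def u(1))
  qed
  moreover have "f (Word u) = f (Word (u @ [False])) + f (Word (u @ [True]))"
    if "Word u \<in> internal T" for u
  proof -
    have fin: "finite (B (u @ [b]))" for b
      by (rule finite_subset[OF _ finite_leaves[OF T]]) (auto simp: B_def)
    have ne: "v \<noteq> u" if "Word v \<in> leaves T" for v
      using that \<open>Word u \<in> internal T\<close> by (auto simp: internal_def)
    have "B u = B (u @ [False]) \<union> B (u @ [True])"
    proof
      show "B u \<subseteq> B (u @ [False]) \<union> B (u @ [True])"
      proof
        fix x assume "x \<in> B u"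
        then obtain z where z: "x = Word (u @ z)" "Word (u @ z) \<in> leaves T"
          by (auto simp: B_def prefix_def)
        obtain b z' where "z = b # z'" using ne[OF z(2)] by (cases z) auto
        then show "x \<in> B (u @ [False]) \<union> B (u @ [True])"
          using z by (cases b) (auto simp: B_def)
      qed
    qed (auto simp: B_def dest: append_prefixD)
    moreover have "B (u @ [False]) \<inter> B (u @ [True]) = {}"
      by (auto simp: B_def prefix_def)
    ultimately show ?thesis using fin by (simp add: f_def sum.union_disjoint)
  qed
  ultimately show ?thesis unfolding extends_coloring_def by blast
qed

lemma extends_coloring_cong:
  assumes T: "finite_binary_tree T" and "\<And>u. Word u \<in> T \<Longrightarrow> f (Word u) = g (Word u)"
  shows "extends_coloring T c f \<longleftrightarrow> extends_coloring T c g"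
proof -
  have "f x = g x" if "x \<in> leaves T" for x
    using leaf_obtain_word[OF T that] assms(2) by metis
  moreover have "f (Word u) = g (Word u)" "f (Word (u @ [b])) = g (Word (u @ [b]))"
    if "Word u \<in> internal T" for u b
    using that assms(2) Word_internal_iff[OF T, of u b] tree_prefix[OF T, of u "[b]"] by auto
  ultimately show ?thesis unfolding extends_coloring_def by auto
qed

text \<open>This replaces the definite description in the definition of the edge coloring by its
  characteristic equations.\<close>

lemma extends_edge_coloring:
  assumes T: "finite_binary_tree T"
  shows "extends_coloring T c (edge_coloring T c)"
proof -
  let ?P = "\<lambda>f. f \<in> tree_edges T \<rightarrow>\<^sub>E UNIV \<and> extends_coloring T c f"
  have *: "edge_coloring T c = (THE f. ?P f)"
    unfolding edge_coloring_def extends_coloring_def color_sum_0_iff ..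
  obtain f where f: "extends_coloring T c f" using extends_coloring_exists[OF T] by blast
  define g where "g = restrict f (tree_edges T)"
  have "extends_coloring T c g"
    using extends_coloring_cong[OF T, of f g] f by (simp add: g_def tree_edges_def)
  then have g: "?P g" by (auto simp: g_def)
  have "h = g" if "?P h" for h
  proof (rule PiE_ext)
    fix x assume x: "x \<in> tree_edges T"
    then obtain u where "x = Word u" "Word u \<in> T" by (cases x) (auto simp: tree_edges_def)
    then show "h x = g x" using extends_coloring_unique[OF T] that g by blast
  qed (use that g in blast)+
  then have "?P (THE f. ?P f)" using g by (intro theI[of ?P g]) blast+
  then show ?thesis using * by simp
qed

lemma edge_coloring_eqI:
  "finite_binary_tree T \<Longrightarrow> extends_coloring T c f \<Longrightarrow> Word u \<in> T \<Longrightarrow>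
     edge_coloring T c (Word u) = f (Word u)"
  using extends_coloring_unique extends_edge_coloring by blast

lemma edge_coloring_leaf:
  "finite_binary_tree T \<Longrightarrow> x \<in> leaves T \<Longrightarrow> edge_coloring T c x = c ! leaf_index T x"
  using extends_edge_coloring unfolding extends_coloring_def by blast

lemma edge_coloring_internal:
  "finite_binary_tree T \<Longrightarrow> Word (u @ [b]) \<in> T \<Longrightarrow> edge_coloring T c (Word u) =
     edge_coloring T c (Word (u @ [False])) + edge_coloring T c (Word (u @ [True]))"
  using extends_edge_coloring[of T c] Word_internal_iff[of T u b]
  unfolding extends_coloring_def by blast

text \<open>Three nonzero colors with sum 0 are distinct, so that a coloring without the color 0 is
  proper.\<close>

lemma valid_coloring_iff:
  assumes T: "finite_binary_tree T"
  shows "valid_coloring T c \<longleftrightarrow>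
    length c = card (leaves T) \<and> (\<forall>u. Word u \<in> T \<longrightarrow> edge_coloring T c (Word u) \<noteq> 0)"
proof -
  let ?f = "edge_coloring T c"
  have edges: "tree_edges T = Word ` {u. Word u \<in> T}"
  proof -
    have "x \<in> Word ` {u. Word u \<in> T}" if "x \<in> T - {Root}" for x
      using that by (cases x) auto
    then show ?thesis unfolding tree_edges_def by auto
  qed
  have "proper_coloring T ?f" if nz: "\<forall>u. Word u \<in> T \<longrightarrow> ?f (Word u) \<noteq> 0"
    unfolding proper_coloring_def edges
  proof clarify
    have node: "?f (Word u) \<noteq> ?f (Word (u @ [a]))" "a \<noteq> b \<Longrightarrow> ?f (Word (u @ [a])) \<noteq> ?f (Word (u @ [b]))"
      if u: "Word (u @ [a]) \<in> T" for u a b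
    proof -
      have "Word u \<in> T" "Word (u @ [False]) \<in> T" "Word (u @ [True]) \<in> T"
        using tree_prefix[OF T u] tree_sibling[OF T u] by auto
      then have "?f (Word u) \<noteq> 0" "?f (Word (u @ [False])) \<noteq> 0" "?f (Word (u @ [True])) \<noteq> 0"
        using nz by auto
      then show "?f (Word u) \<noteq> ?f (Word (u @ [a]))"
          "a \<noteq> b \<Longrightarrow> ?f (Word (u @ [a])) \<noteq> ?f (Word (u @ [b]))"
        using edge_coloring_internal[OF T u, of c] color_add_eq_0_iff
        by (cases a; cases b; simp; metis)+
    qed
    fix x y assume x: "Word x \<in> T" and y: "Word y \<in> T"
      and adj: "adjacent_edges (Word x) (Word y)" and eq: "?f (Word x) = ?f (Word y)"
    consider b where "y = x @ [b]" | b where "x = y @ [b]"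
      | u a b where "x = u @ [a]" "y = u @ [b]" "a \<noteq> b"
      using adj by (cases x rule: rev_exhaust; cases y rule: rev_exhaust)
        (auto simp: adjacent_edges_def split: if_splits)
    then show False
      using node x y eq by cases metis+
  qed
  then show ?thesis
    unfolding valid_coloring_def edges by (auto simp: color_nonzero_iff image_subset_iff)
qed

lemma derived_signs_eq:
  assumes "finite_binary_tree T" "Word (u @ [b]) \<in> T"
  shows "derived_signs T c (Word u) = vertex_sign (edge_coloring T c (Word u))
    (edge_coloring T c (Word (u @ [False]))) (edge_coloring T c (Word (u @ [True])))"
  using assms Word_internal_iff[of T u b] by (simp add: derived_signs_def vertex_sign_def Let_def)

section \<open>Rotating a colored tree\<close>

text \<open>Here \<open>X\<close>, \<open>Y\<close>, \<open>Z\<close> are the colors of the three edges below the pivot vertices; the edge between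
  the pivot vertices has color \<open>X + Y\<close> before and \<open>Y + Z\<close> after the rotation. Either side of the
  equivalence says that \<open>X = Z \<noteq> Y\<close>, a condition that does not see the direction of the rotation.
  It also explains why equal signs are reversed: both pivot vertices see the colors \<open>X\<close>, \<open>Y\<close>
  and \<open>X + Y\<close> before and after, and the cyclic order changes.\<close>

lemma comb_signs:
  fixes X Y Z :: color
  assumes "X \<noteq> 0" "Y \<noteq> 0" "Z \<noteq> 0" "X + Y + Z \<noteq> 0"
  defines "a \<equiv> vertex_sign (X + Y + Z) (X + Y) Z" and "b \<equiv> vertex_sign (X + Y) X Y"
    and "a' \<equiv> vertex_sign (X + Y + Z) X (Y + Z)" and "b' \<equiv> vertex_sign (Y + Z) Y Z"
  shows "X + Y \<noteq> 0 \<and> a = b \<longleftrightarrow> Y + Z \<noteq> 0 \<and> a' = b'"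
    and "X + Y \<noteq> 0 \<Longrightarrow> a = b \<Longrightarrow> a' = flip b \<and> b' = flip a"
  using assms
  by (cases X rule: color_cases; cases Y rule: color_cases; cases Z rule: color_cases;
      simp add: vertex_sign_def)+

context rotation_pair
begin

abbreviation fL where "fL c x \<equiv> edge_coloring L c (Word x)"
abbreviation fR where "fR c x \<equiv> edge_coloring R c (Word x)"

lemma inv_rot_rot [simp]: "inv (rot u) (rot u x) = x"
  by (rule inv_f_f[OF bij_is_inj[OF bij_rot]])

lemma rot_inv_rot [simp]: "rot u (inv (rot u) x) = x"
  by (rule surj_f_inv_f[OF bij_is_surj[OF bij_rot]])

lemma inv_rot_simps:
  "\<not> prefix u y \<Longrightarrow> inv (rot u) (Word y) = Word y"
  "inv (rot u) (Word u) = Word (u @ [False])"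
  "inv (rot u) (Word (u @ [True])) = Word u"
  "inv (rot u) (Word (u @ False # v)) = Word (u @ False # False # v)"
  "inv (rot u) (Word (u @ True # False # v)) = Word (u @ False # True # v)"
  "inv (rot u) (Word (u @ True # True # v)) = Word (u @ True # v)"
  using inv_rot_rot[of "Word y"] inv_rot_rot[of "Word (u @ [False])"] inv_rot_rot[of "Word u"]
    inv_rot_rot[of "Word (u @ False # False # v)"] inv_rot_rot[of "Word (u @ False # True # v)"]
    inv_rot_rot[of "Word (u @ True # v)"]
  by (simp_all add: rotate_word_outside)

lemma rot_eq_pivot:
  "rot u x = Word u \<longleftrightarrow> x = Word (u @ [False])"
  "rot u x = Word (u @ [True]) \<longleftrightarrow> x = Word u"
  using inv_rot_simps(2,3) inv_rot_rot rot_inv_rot by metis+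

lemma colors_comb:
  "fL c u = fL c (u @ [False]) + fL c (u @ [True])"
  "fL c (u @ [False]) = fL c (u @ [False, False]) + fL c (u @ [False, True])"
  using edge_coloring_internal[OF L, of u False c] left_comb left_comb_mem
    edge_coloring_internal[OF L, of "u @ [False]" False c] by simp_all

text \<open>A rotation keeps the colors of all edges except the one between the two pivot vertices.\<close>

lemma colors_R:
  "\<not> prefix u y \<Longrightarrow> Word y \<in> R \<Longrightarrow> fR c y = fL c y"
  "fR c u = fL c u"
  "fR c (u @ [True]) = fL c (u @ [False, True]) + fL c (u @ [True])"
  "Word (u @ False # v) \<in> R \<Longrightarrow> fR c (u @ False # v) = fL c (u @ False # False # v)"
  "Word (u @ True # False # v) \<in> R \<Longrightarrow> fR c (u @ True # False # v) = fL c (u @ False # True # v)"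
  "Word (u @ True # True # v) \<in> R \<Longrightarrow> fR c (u @ True # True # v) = fL c (u @ True # v)"
proof -
  \<comment> \<open>The expected coloring of \<open>R\<close>; that it satisfies the equations at all vertices identifies it.\<close>
  define h where "h x = (if x = Word u then fL c u
    else if x = Word (u @ [True]) then fL c (u @ [False, True]) + fL c (u @ [True])
    else edge_coloring L c (inv (rot u) x))" for x
  have h1: "h (Word y) = fL c y" if "\<not> prefix u y" for y
    using that by (auto simp: h_def inv_rot_simps)
  have h2: "h (Word u) = fL c u"
    "h (Word (u @ [True])) = fL c (u @ [False, True]) + fL c (u @ [True])"
    "h (Word (u @ False # v)) = fL c (u @ False # False # v)"
    "h (Word (u @ True # False # v)) = fL c (u @ False # True # v)"
    "h (Word (u @ True # True # v)) = fL c (u @ True # v)" for v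
    by (simp_all add: h_def inv_rot_simps)
  note node = edge_coloring_internal[OF L, of _ False c]
  have "extends_coloring R c h"
    unfolding extends_coloring_def
  proof (intro conjI ballI allI impI)
    fix y assume "y \<in> leaves R"
    then obtain x where x: "y = rot u x" "x \<in> leaves L" by (auto simp: leaves_R)
    have "x \<noteq> Word u" "x \<noteq> Word (u @ [False])"
      using x(2) left_comb left_comb_mem leaf_iff[OF L, of x False] by auto
    then show "h y = c ! leaf_index R y"
      using x edge_coloring_leaf[OF L x(2)]
      by (simp add: h_def rot_eq_pivot leaf_index_R)
  next
    fix y assume "Word y \<in> internal R"
    then have y: "Word (y @ [False]) \<in> R" using Word_internal_iff[OF R] by blast
    show "h (Word y) = h (Word (y @ [False])) + h (Word (y @ [True]))"
    proof (cases u y rule: word_cases_right)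
      case 1
      have "h (Word (y @ [b])) = fL c (y @ [b])" for b
        using 1 h1 h2(1) by (cases "prefix u (y @ [b])") auto
      moreover have "Word y \<in> internal L"
        using internal_R_iff[of "Word y"] 1 \<open>Word y \<in> internal R\<close> by (simp add: rotate_word_outside)
      then have "Word (y @ [False]) \<in> L" using Word_internal_iff[OF L] by blast
      ultimately show ?thesis using 1 node[of y] by (simp add: h1)
    next
      case 2
      then show ?thesis using colors_comb by (simp add: h2 add.assoc)
    next
      case 3
      then show ?thesis by (simp add: h2)
    next
      case (4 v)
      then show ?thesis using y node[of "u @ False # False # v"] by (simp add: h2 mem_R)
    next
      case (5 v)
      then show ?thesis using y node[of "u @ False # True # v"] by (simp add: h2 mem_R)
    next
      case (6 v)
      then show ?thesis using y node[of "u @ True # v"] by (simp add: h2 mem_R)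
    qed
  qed
  note eq = edge_coloring_eqI[OF R this]
  show "\<not> prefix u y \<Longrightarrow> Word y \<in> R \<Longrightarrow> fR c y = fL c y"
    "fR c u = fL c u"
    "fR c (u @ [True]) = fL c (u @ [False, True]) + fL c (u @ [True])"
    "Word (u @ False # v) \<in> R \<Longrightarrow> fR c (u @ False # v) = fL c (u @ False # False # v)"
    "Word (u @ True # False # v) \<in> R \<Longrightarrow> fR c (u @ True # False # v) = fL c (u @ False # True # v)"
    "Word (u @ True # True # v) \<in> R \<Longrightarrow> fR c (u @ True # True # v) = fL c (u @ True # v)"
    using eq h1 h2 right_comb_mem by simp_all
qed

text \<open>So the only color that can become 0, or cease to be 0, is that of the edge between the pivots.\<close>

lemma nonzero_off_pivot_edge:
  "(\<forall>x. Word x \<in> L \<longrightarrow> x \<noteq> u @ [False] \<longrightarrow> fL c x \<noteq> 0) \<longleftrightarrow>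
   (\<forall>y. Word y \<in> R \<longrightarrow> y \<noteq> u @ [True] \<longrightarrow> fR c y \<noteq> 0)" (is "?l \<longleftrightarrow> ?r")
proof
  assume l: ?l
  show ?r
  proof (intro allI impI)
    fix y assume y: "Word y \<in> R" "y \<noteq> u @ [True]"
    show "fR c y \<noteq> 0"
    proof (cases u y rule: word_cases_right)
      case 2
      then show ?thesis using l left_comb_mem colors_R(2)[of c] by simp
    qed (use l y in \<open>auto simp: colors_R mem_R\<close>)
  qed
next
  assume r: ?r
  show ?l
  proof (intro allI impI)
    fix x assume x: "Word x \<in> L" "x \<noteq> u @ [False]"
    show "fL c x \<noteq> 0"
    proof (cases u x rule: word_cases_left)
      case 1
      then have "x \<noteq> u @ [True]" by auto
      then show ?thesis using r[rule_format, of x] x 1 by (simp add: colors_R mem_R)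
    next
      case 2
      then show ?thesis using r[rule_format, of u] right_comb_mem by (simp add: colors_R)
    next
      case (4 v)
      then show ?thesis using r[rule_format, of "u @ False # v"] x by (simp add: colors_R mem_R)
    next
      case (5 v)
      then show ?thesis using r[rule_format, of "u @ True # False # v"] x by (simp add: colors_R mem_R)
    next
      case (6 v)
      then show ?thesis using r[rule_format, of "u @ True # True # v"] x by (simp add: colors_R mem_R)
    qed (use x in simp)
  qed
qed

lemma derived_signs_comb:
  defines "X c \<equiv> fL c (u @ [False, False])" and "Y c \<equiv> fL c (u @ [False, True])"
    and "Z c \<equiv> fL c (u @ [True])"
  shows "derived_signs L c (Word u) = vertex_sign (X c + Y c + Z c) (X c + Y c) (Z c)"
    "derived_signs L c (Word (u @ [False])) = vertex_sign (X c + Y c) (X c) (Y c)"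
    "derived_signs R c (Word u) = vertex_sign (X c + Y c + Z c) (X c) (Y c + Z c)"
    "derived_signs R c (Word (u @ [True])) = vertex_sign (Y c + Z c) (Y c) (Z c)"
  using derived_signs_eq[OF L, of u False c] derived_signs_eq[OF L, of "u @ [False]" False c]
    derived_signs_eq[OF R, of u True c] derived_signs_eq[OF R, of "u @ [True]" True c]
    left_comb left_comb_mem colors_comb[of c] colors_R(2,3)[of c] colors_R(4-)[of "[]" c]
  unfolding assms by (simp_all add: mem_R)

lemma derived_signs_off_pivots:
  assumes "x \<in> internal L" "x \<noteq> Word u" "x \<noteq> Word (u @ [False])"
  shows "derived_signs R c (rot u x) = derived_signs L c x"
proof -
  obtain z where z: "x = Word z" "Word (z @ [False]) \<in> L"
    using assms(1) internal_iff[OF L, of x False] by blast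
  have zT: "Word (z @ [True]) \<in> L" using tree_sibling[OF L z(2)] .
  have zm: "Word z \<in> L" using tree_prefix[OF L z(2)] .
  note dL = derived_signs_eq[OF L z(2), of c]
  show ?thesis
  proof (cases u z rule: word_cases_left)
    case 1
    have mem: "Word (z @ [b]) \<in> R \<and> fR c (z @ [b]) = fL c (z @ [b])" for b
    proof (cases "prefix u (z @ [b])")
      case True
      then have "z @ [b] = u" using 1 by auto
      then show ?thesis using right_comb_mem colors_R(2)[of c] by simp
    qed (use z(2) zT in \<open>cases b; simp add: mem_R colors_R\<close>)
    then show ?thesis
      using 1 zm z(1) derived_signs_eq[OF R, of z False c] dL
      by (simp add: rotate_word_outside colors_R mem_R)
  next
    case (4 v)
    then show ?thesis
      using zm z zT derived_signs_eq[OF R, of "u @ False # v" False c] dL by (simp add: colors_R mem_R)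
  next
    case (5 v)
    then show ?thesis
      using zm z zT derived_signs_eq[OF R, of "u @ True # False # v" False c] dL
      by (simp add: colors_R mem_R)
  next
    case (6 v)
    then show ?thesis
      using zm z zT derived_signs_eq[OF R, of "u @ True # True # v" False c] dL
      by (simp add: colors_R mem_R)
  qed (use assms z in auto)
qed

lemma valid_with_equal_signs_iff:
  "valid_coloring L c \<and> derived_signs L c (Word u) = derived_signs L c (Word (u @ [False])) \<longleftrightarrow>
   valid_coloring R c \<and> derived_signs R c (Word u) = derived_signs R c (Word (u @ [True]))"
  (is ?iff)
  and derived_signs_rotated:
  "valid_coloring L c \<Longrightarrow> derived_signs L c (Word u) = derived_signs L c (Word (u @ [False])) \<Longrightarrow>
   x \<in> internal L \<Longrightarrow> derived_signs R c (rot u x) =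
     (if x \<in> {Word u, Word (u @ [False])} then flip (derived_signs L c x) else derived_signs L c x)"
proof -
  define X Y Z where XYZ: "X = fL c (u @ [False, False])" "Y = fL c (u @ [False, True])"
    "Z = fL c (u @ [True])"
  have mid: "fL c (u @ [False]) = X + Y" "fR c (u @ [True]) = Y + Z" "fL c u = X + Y + Z"
    using colors_comb[of c] colors_R(3)[of c] by (simp_all add: XYZ)
  define off where "off \<longleftrightarrow> (\<forall>x. Word x \<in> L \<longrightarrow> x \<noteq> u @ [False] \<longrightarrow> fL c x \<noteq> 0)"
  have nz: "X \<noteq> 0" "Y \<noteq> 0" "Z \<noteq> 0" "X + Y + Z \<noteq> 0" if off
    using that left_comb left_comb_mem unfolding off_def XYZ mid(3)[unfolded XYZ, symmetric] by auto
  have vL: "valid_coloring L c \<longleftrightarrow> length c = card (leaves L) \<and> off \<and> X + Y \<noteq> 0"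
    using left_comb_mem(2) mid(1) unfolding valid_coloring_iff[OF L] off_def by metis
  have vR: "valid_coloring R c \<longleftrightarrow> length c = card (leaves L) \<and> off \<and> Y + Z \<noteq> 0"
    using right_comb_mem(2) mid(2)
    unfolding valid_coloring_iff[OF R] off_def nonzero_off_pivot_edge card_leaves_R by metis
  note d = derived_signs_comb[of c, folded XYZ]
  show ?iff unfolding vL vR d using comb_signs(1)[of X Y Z] nz by blast
  assume v: "valid_coloring L c" and s: "derived_signs L c (Word u) = derived_signs L c (Word (u @ [False]))"
    and x: "x \<in> internal L"
  have "X + Y \<noteq> 0" off using v vL by auto
  then have "derived_signs R c (Word u) = flip (derived_signs L c (Word (u @ [False])))"
      "derived_signs R c (Word (u @ [True])) = flip (derived_signs L c (Word u))"
    using comb_signs(2)[of X Y Z] nz s unfolding d by blast+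
  then show "derived_signs R c (rot u x) =
     (if x \<in> {Word u, Word (u @ [False])} then flip (derived_signs L c x) else derived_signs L c x)"
    using derived_signs_off_pivots[OF x] by auto
qed

end

lemma internal_rotate_tree:
  assumes "finite_binary_tree T" "applies v T"
  shows "finite_binary_tree (rotate_tree T v)"
    and "internal (rotate_tree T v) = perm v ` internal T"
proof -
  have "finite_binary_tree (rotate_tree T v) \<and> internal (rotate_tree T v) = perm v ` internal T"
  proof (cases v)
    case (Rot u)
    interpret rotation_pair u T "rotate_tree T v"
      using rotation_pair_Rot assms Rot by blast
    show ?thesis using R internal_R Rot by simp
  next
    case (Bar u)
    interpret rotation_pair u "rotate_tree T v" T
      using rotation_pair_Bar assms Bar by blast
    show ?thesis using L internal_R Bar by (simp add: image_comp comp_def)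
  qed
  then show "finite_binary_tree (rotate_tree T v)"
    and "internal (rotate_tree T v) = perm v ` internal T" by auto
qed

text \<open>The link between signs and colors: a valid rotation keeps a coloring valid, and it changes the
  derived signs by the rule that defines the action of rotations on sign assignments.\<close>

lemma valid_coloring_rotate:
  assumes T: "finite_binary_tree T" and c: "valid_coloring T c"
    and v: "valid_rotation T (derived_signs T c) v"
  shows "valid_coloring (rotate_tree T v) c"
    and "derived_signs (rotate_tree T v) c = rotate_signs T (derived_signs T c) v"
proof -
  have app: "applies v T" using v by (simp add: valid_rotation_def)
  let ?T' = "rotate_tree T v"
  have "valid_coloring ?T' c \<and> (\<forall>y \<in> internal ?T'.
    derived_signs ?T' c y = rotate_signs T (derived_signs T c) v y)"
  proof (cases v)
    case (Rot u)
    interpret rotation_pair u T ?T'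
      using rotation_pair_Rot T app Rot by blast
    have s: "derived_signs T c (Word u) = derived_signs T c (Word (u @ [False]))"
      using v Rot by (simp add: valid_rotation_def)
    have "derived_signs ?T' c y = rotate_signs T (derived_signs T c) v y" if y: "y \<in> internal ?T'" for y
    proof -
      obtain x where "y = rot u x" "x \<in> internal T" using y by (auto simp: internal_R)
      then show ?thesis
        using derived_signs_rotated[OF c s, of x] y Rot
        by (simp add: rotate_signs_def pivots_def Let_def del: rot_Word)
    qed
    then show ?thesis using valid_with_equal_signs_iff[of c] c s by blast
  next
    case (Bar u)
    interpret rotation_pair u ?T' T
      using rotation_pair_Bar T app Bar by blast
    have "derived_signs T c (Word u) = derived_signs T c (Word (u @ [True]))"
      using v Bar by (simp add: valid_rotation_def)
    then have v': "valid_coloring ?T' c"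
      and s: "derived_signs ?T' c (Word u) = derived_signs ?T' c (Word (u @ [False]))"
      using valid_with_equal_signs_iff[of c] c by auto
    have "inv (inv (rot u)) = rot u" by (rule inv_inv_eq[OF bij_rot])
    then have "derived_signs ?T' c y = rotate_signs T (derived_signs T c) v y"
      if "y \<in> internal ?T'" for y
      using that derived_signs_rotated[OF v' s, of y] Bar
      by (auto simp: rotate_signs_def pivots_def Let_def rot_eq_pivot simp del: rot_Word)
    then show ?thesis using v' by blast
  qed
  then show "valid_coloring ?T' c"
    and "derived_signs ?T' c = rotate_signs T (derived_signs T c) v"
    by (auto simp: derived_signs_def rotate_signs_def fun_eq_iff)
qed

section \<open>Colorings from sign assignments\<close>

definition cycle_color :: "color \<Rightarrow> color" where
  "cycle_color a = (if a = color1 then color2 else if a = color2 then color3 else color1)"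

definition child_color :: "sign \<Rightarrow> bool \<Rightarrow> color \<Rightarrow> color" where
  "child_color s b a = (if (s = Plus) = b then cycle_color (cycle_color a) else cycle_color a)"

lemma child_color:
  assumes "a \<noteq> 0"
  shows "child_color s b a \<noteq> 0" "a = child_color s False a + child_color s True a"
    "vertex_sign a (child_color s False a) (child_color s True a) = s"
  using assms
  by (cases s; cases b; cases a rule: color_cases;
      simp add: child_color_def cycle_color_def vertex_sign_def)+

lemma child_color_vertex_sign:
  assumes "x \<noteq> 0" "y \<noteq> 0" "x + y \<noteq> 0"
  shows "x = child_color (vertex_sign (x + y) x y) False (x + y)"
    "y = child_color (vertex_sign (x + y) x y) True (x + y)"
  using assms
  by (cases x rule: color_cases; cases y rule: color_cases;
      simp add: child_color_def cycle_color_def vertex_sign_def)+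

text \<open>The argument of the recursion is the reversed word, so that it ascends towards the root.\<close>

fun descend_color :: "(vertex \<Rightarrow> sign) \<Rightarrow> word \<Rightarrow> color" where
  "descend_color \<sigma> [] = color1"
| "descend_color \<sigma> (b # u) = child_color (\<sigma> (Word (rev u))) b (descend_color \<sigma> u)"

lemma descend_color_nonzero: "descend_color \<sigma> u \<noteq> 0"
  by (induction u) (simp_all add: child_color(1))

text \<open>The color of the edge at the root and the signs determine all colors from the top down, and
  no choice of signs leads to a conflict.\<close>

lemma coloring_with_signs_exists:
  assumes T: "finite_binary_tree T"
  shows "\<exists>c. valid_coloring T c \<and> edge_coloring T c (Word []) = color1 \<and>
    (\<forall>x \<in> internal T. derived_signs T c x = \<sigma> x)"
proof -
  define f where "f x = (case x of Root \<Rightarrow> 0 | Word u \<Rightarrow> descend_color \<sigma> (rev u))" for x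
  have f: "f (Word []) = color1" "f (Word u) \<noteq> 0"
    "f (Word (u @ [b])) = child_color (\<sigma> (Word u)) b (f (Word u))" for u b
    by (simp_all add: f_def descend_color_nonzero)
  define c where "c = map (\<lambda>i. f (inv_into (leaves T) (leaf_index T) i)) [0..<card (leaves T)]"
  have "f x = c ! leaf_index T x" if "x \<in> leaves T" for x
    using bij_betw_leaf_index[OF T] leaf_index_less[OF T] that by (simp add: c_def bij_betw_def)
  then have "extends_coloring T c f"
    unfolding extends_coloring_def f(3) using child_color(2)[OF f(2)] by blast
  note eq = edge_coloring_eqI[OF T this]
  have root: "Word [] \<in> T" using T by (simp add: finite_binary_tree_def)
  have "derived_signs T c x = \<sigma> x" if x: "x \<in> internal T" for x
  proof -
    obtain u where u: "x = Word u" "Word (u @ [False]) \<in> T" using x internal_iff[OF T, of x False] by blast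
    have "Word u \<in> T" "Word (u @ [True]) \<in> T"
      using tree_prefix[OF T u(2)] tree_sibling[OF T u(2)] by auto
    then show ?thesis
      using derived_signs_eq[OF T u(2), of c] eq u f(3) child_color(3)[OF f(2)] by simp
  qed
  moreover have "valid_coloring T c"
    using eq f(2) by (simp add: valid_coloring_iff[OF T] c_def)
  ultimately show ?thesis using eq[OF root] f(1) by auto
qed

lemma coloring_with_signs_unique:
  assumes T: "finite_binary_tree T" and c: "valid_coloring T c" "valid_coloring T c'"
    and root: "edge_coloring T c (Word []) = edge_coloring T c' (Word [])"
    and signs: "derived_signs T c = derived_signs T c'"
  shows "c = c'"
proof -
  have "edge_coloring T c (Word u) = edge_coloring T c' (Word u)" if "Word u \<in> T" for u
    using that
  proof (induction u rule: rev_induct)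
    case Nil
    show ?case by (rule root)
  next
    case (snoc b u)
    have mem: "Word u \<in> T" "Word (u @ [a]) \<in> T" for a
      using tree_prefix[OF T snoc(2)] tree_sibling[OF T snoc(2)] by auto
    have child: "edge_coloring T e (Word (u @ [b])) =
        child_color (derived_signs T e (Word u)) b (edge_coloring T e (Word u))"
      if "valid_coloring T e" for e
    proof -
      let ?a = "edge_coloring T e (Word u)"
      let ?x = "edge_coloring T e (Word (u @ [False]))" and ?y = "edge_coloring T e (Word (u @ [True]))"
      have sum: "?a = ?x + ?y" by (rule edge_coloring_internal[OF T mem(2)])
      have "?a \<noteq> 0" "?x \<noteq> 0" "?y \<noteq> 0"
        using that mem unfolding valid_coloring_iff[OF T] by blast+
      then have "?x = child_color (vertex_sign ?a ?x ?y) False ?a"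
          "?y = child_color (vertex_sign ?a ?x ?y) True ?a"
        using child_color_vertex_sign[of ?x ?y] unfolding sum by blast+
      then show ?thesis
        using derived_signs_eq[OF T mem(2), of e] by (cases b) metis+
    qed
    show ?case using child[OF c(1)] child[OF c(2)] snoc(1)[OF mem(1)] signs by simp
  qed
  then have leaf: "c ! leaf_index T x = c' ! leaf_index T x" if "x \<in> leaves T" for x
    using that edge_coloring_leaf[OF T that] leaf_obtain_word[OF T that] by metis
  show ?thesis
  proof (rule nth_equalityI)
    show "length c = length c'" using c by (simp add: valid_coloring_def)
    fix i assume "i < length c"
    then have "i \<in> leaf_index T ` leaves T"
      using c bij_betw_leaf_index[OF T] by (simp add: valid_coloring_def bij_betw_def)
    then show "c ! i = c' ! i" using leaf by auto
  qed
qed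

lemma bij_betw_derived_signs:
  assumes T: "finite_binary_tree T"
  shows "bij_betw (derived_signs T)
    {c. valid_coloring T c \<and> edge_coloring T c (Word []) = color1} (sign_assignments T)"
proof (rule bij_betw_imageI)
  show "inj_on (derived_signs T) {c. valid_coloring T c \<and> edge_coloring T c (Word []) = color1}"
    using coloring_with_signs_unique[OF T] by (auto intro!: inj_onI)
  have mem: "derived_signs T c \<in> sign_assignments T" for c
    by (auto simp: derived_signs_def sign_assignments_def)
  have "\<exists>c. valid_coloring T c \<and> edge_coloring T c (Word []) = color1 \<and> derived_signs T c = \<sigma>"
    if \<sigma>: "\<sigma> \<in> sign_assignments T" for \<sigma>
  proof -
    obtain c where c: "valid_coloring T c" "edge_coloring T c (Word []) = color1"
      "\<forall>x \<in> internal T. derived_signs T c x = \<sigma> x"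
      using coloring_with_signs_exists[OF T] by blast
    moreover have "derived_signs T c = \<sigma>"
      using mem[of c] \<sigma> c(3) unfolding sign_assignments_def by (intro PiE_ext) auto
    ultimately show ?thesis by blast
  qed
  then show "derived_signs T ` {c. valid_coloring T c \<and> edge_coloring T c (Word []) = color1} =
      sign_assignments T"
    using mem by fastforce
qed

section \<open>The signed graph of a path\<close>

lemma bij_perm: "bij (perm v)"
  by (cases v) (simp_all add: bij_rot bij_imp_bij_inv)

text \<open>The sign assignment carried along the path. Like the rule for a single rotation, it is defined
  whether or not the rotations are valid.\<close>

primrec path_signs :: "vertex set \<Rightarrow> (vertex \<Rightarrow> sign) \<Rightarrow> rotation list \<Rightarrow> vertex \<Rightarrow> sign" where
  "path_signs T \<sigma> [] = \<sigma>"
| "path_signs T \<sigma> (v # w) = path_signs (rotate_tree T v) (rotate_signs T \<sigma> v) w"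

lemma path_snoc:
  "path_end T (w @ [v]) = rotate_tree (path_end T w) v"
  "path_perm (w @ [v]) = perm v \<circ> path_perm w"
  "edge_path T (w @ [v]) \<longleftrightarrow> edge_path T w \<and> applies v (path_end T w)"
  "path_signs T \<sigma> (w @ [v]) = rotate_signs (path_end T w) (path_signs T \<sigma> w) v"
  "valid_path T \<sigma> (w @ [v]) \<longleftrightarrow>
     valid_path T \<sigma> w \<and> valid_rotation (path_end T w) (path_signs T \<sigma> w) v"
proof -
  show "path_end T (w @ [v]) = rotate_tree (path_end T w) v"
    "path_perm (w @ [v]) = perm v \<circ> path_perm w"
    by (simp_all add: path_end_def path_perm_def)
  show "edge_path T (w @ [v]) \<longleftrightarrow> edge_path T w \<and> applies v (path_end T w)"
    by (induction w arbitrary: T) (simp_all add: path_end_def)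
  show "path_signs T \<sigma> (w @ [v]) = rotate_signs (path_end T w) (path_signs T \<sigma> w) v"
    by (induction w arbitrary: T \<sigma>) (simp_all add: path_end_def)
  show "valid_path T \<sigma> (w @ [v]) \<longleftrightarrow>
     valid_path T \<sigma> w \<and> valid_rotation (path_end T w) (path_signs T \<sigma> w) v"
    by (induction w arbitrary: T \<sigma>) (simp_all add: path_end_def)
qed

lemma bij_path_perm: "bij (path_perm w)"
proof (induction w rule: rev_induct)
  case Nil
  show ?case using bij_id by (simp add: path_perm_def id_def)
next
  case (snoc v w)
  then show ?case unfolding path_snoc by (rule bij_comp[OF _ bij_perm])
qed

lemma path_end_tree:
  assumes "finite_binary_tree D" "edge_path D w"
  shows "finite_binary_tree (path_end D w) \<and> internal (path_end D w) = path_perm w ` internal D"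
  using assms(2)
proof (induction w rule: rev_induct)
  case Nil
  then show ?case using assms(1) by (simp add: path_end_def path_perm_def)
next
  case (snoc v w)
  then show ?case
    using internal_rotate_tree[of "path_end D w" v] by (auto simp: path_snoc image_comp)
qed

lemma Sigma_upto_append: "i \<le> length w \<Longrightarrow> Sigma_upto (w @ w') i = Sigma_upto w i"
  by (induction i) (simp_all add: nth_append)

lemma Sigma_graph_snoc:
  fixes w :: "rotation list" and v :: rotation
  defines "s \<equiv> inv (path_perm w) (pivot1 v)" and "t \<equiv> inv (path_perm w) (pivot2 v)"
  shows "Sigma_graph (w @ [v]) = Sigma_graph w @ [(s, t,
    if even (degree (Sigma_graph w) s + degree (Sigma_graph w) t) then Plus else Minus)]"
  by (simp add: Sigma_graph_def Sigma_upto_append s_def t_def Let_def)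

lemma degree_snoc:
  "degree (G @ [(s, t, b)]) x = degree G x + (if x = s then 1 else 0) + (if x = t then 1 else 0)"
  by (simp add: degree_def)

lemma pivot_preimages:
  assumes "finite_binary_tree D" "edge_path D (w @ [v])"
  defines "s \<equiv> inv (path_perm w) (pivot1 v)" and "t \<equiv> inv (path_perm w) (pivot2 v)"
  shows "path_perm w s = pivot1 v" "path_perm w t = pivot2 v"
    "s \<in> internal D" "t \<in> internal D" "s \<noteq> t"
proof -
  show st: "path_perm w s = pivot1 v" "path_perm w t = pivot2 v"
    unfolding s_def t_def by (simp_all add: surj_f_inv_f[OF bij_is_surj[OF bij_path_perm]])
  have "pivot1 v \<in> path_perm w ` internal D" "pivot2 v \<in> path_perm w ` internal D"
    using assms(1,2) path_end_tree[of D w] by (auto simp: path_snoc applies_def pivots_def)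
  then show "s \<in> internal D" "t \<in> internal D"
    unfolding s_def t_def by (auto simp: inv_f_f[OF bij_is_inj[OF bij_path_perm]])
  have "pivot1 v \<noteq> pivot2 v" by (cases v) auto
  then show "s \<noteq> t" using st by auto
qed

lemma Sigma_graph_in_internal:
  assumes "finite_binary_tree D" "edge_path D w"
  shows "\<forall>(s, t, b) \<in> set (Sigma_graph w). s \<in> internal D \<and> t \<in> internal D"
  using assms(2)
proof (induction w rule: rev_induct)
  case Nil
  then show ?case by (simp add: Sigma_graph_def)
next
  case (snoc v w)
  then show ?case
    using pivot_preimages(3,4)[OF assms(1) snoc(2)] by (simp add: Sigma_graph_snoc path_snoc)
qed

text \<open>Every rotation reverses the signs of its two pivot vertices, the ends of the edge that it
  contributes to the graph. So the sign that a vertex of the initial tree has after the path is the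
  initial one, reversed as often as the degree of the vertex says.\<close>

lemma path_signs_degree:
  assumes "finite_binary_tree D" "edge_path D w" "x \<in> internal D"
  shows "path_signs D \<sigma> w (path_perm w x) = (flip ^^ degree (Sigma_graph w) x) (\<sigma> x)"
  using assms(2)
proof (induction w rule: rev_induct)
  case Nil
  then show ?case by (simp add: Sigma_graph_def path_perm_def degree_def)
next
  case (snoc v w)
  define s t where "s = inv (path_perm w) (pivot1 v)" and "t = inv (path_perm w) (pivot2 v)"
  note st = pivot_preimages[OF assms(1) snoc(2), folded s_def t_def]
  have path: "edge_path D w" "applies v (path_end D w)" using snoc(2) by (simp_all add: path_snoc)
  have inj: "inj (path_perm w)" by (rule bij_is_inj[OF bij_path_perm])
  have "path_perm w x \<in> pivots v \<longleftrightarrow> x = s \<or> x = t"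
    unfolding pivots_def st(1,2)[symmetric] using inj_eq[OF inj] by auto
  moreover have "perm v (path_perm w x) \<in> internal (rotate_tree (path_end D w) v)"
    using path_end_tree[OF assms(1) path(1)] internal_rotate_tree(2)[OF _ path(2)] assms(3) by auto
  moreover have "inv (perm v) (perm v y) = y" for y
    by (rule inv_f_f[OF bij_is_inj[OF bij_perm]])
  ultimately show ?case
    using snoc(1)[OF path(1)] st(5)
    by (simp add: path_snoc rotate_signs_def Let_def Sigma_graph_snoc degree_snoc
        s_def[symmetric] t_def[symmetric])
qed

text \<open>By the degree formula the two pivot vertices of the next rotation carry equal signs iff their
  initial signs agree up to the parity of the sum of the degrees, which is what the sign of the new
  edge records.\<close>

lemma valid_path_iff_compatible:
  assumes "finite_binary_tree D" "edge_path D w"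
  shows "valid_path D \<sigma> w \<longleftrightarrow> compatible \<sigma> (Sigma_graph w)"
  using assms(2)
proof (induction w rule: rev_induct)
  case Nil
  then show ?case by (simp add: Sigma_graph_def compatible_def)
next
  case (snoc v w)
  define s t where "s = inv (path_perm w) (pivot1 v)" and "t = inv (path_perm w) (pivot2 v)"
  note st = pivot_preimages[OF assms(1) snoc(2), folded s_def t_def]
  have path: "edge_path D w" "applies v (path_end D w)" using snoc(2) by (simp_all add: path_snoc)
  note deg = path_signs_degree[OF assms(1) path(1)]
  have "valid_rotation (path_end D w) (path_signs D \<sigma> w) v \<longleftrightarrow>
      (flip ^^ degree (Sigma_graph w) s) (\<sigma> s) = (flip ^^ degree (Sigma_graph w) t) (\<sigma> t)"
    using path(2) deg[OF st(3)] deg[OF st(4)] st(1,2) by (simp add: valid_rotation_def)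
  also have "\<dots> \<longleftrightarrow> (even (degree (Sigma_graph w) s + degree (Sigma_graph w) t) \<longleftrightarrow> \<sigma> s = \<sigma> t)"
    by (cases "\<sigma> s"; cases "\<sigma> t") (auto simp: funpow_flip)
  finally show ?case
    using snoc(1)[OF path(1)]
    by (auto simp: path_snoc Sigma_graph_snoc compatible_def s_def[symmetric] t_def[symmetric])
qed

lemma valid_coloring_path_end:
  assumes "finite_binary_tree T" "valid_coloring T c" "valid_path T (derived_signs T c) w"
  shows "valid_coloring (path_end T w) c"
  using assms
proof (induction w arbitrary: T)
  case Nil
  then show ?case by (simp add: path_end_def)
next
  case (Cons v w)
  then have v: "valid_rotation T (derived_signs T c) v" by simp
  then have "finite_binary_tree (rotate_tree T v)"
    using internal_rotate_tree(1) Cons(2) by (simp add: valid_rotation_def)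
  then have "valid_coloring (path_end (rotate_tree T v) w) c"
    using Cons valid_coloring_rotate[OF Cons(2,3) v] by simp
  then show ?case by (simp add: path_end_def)
qed

section \<open>Permuting the colors\<close>

lemma permutes_colors:
  assumes "\<pi> permutes {color1, color2, color3}"
  shows "\<pi> 0 = 0" and "(\<pi> color1, \<pi> color2, \<pi> color3) \<in>
    {(color1, color2, color3), (color2, color3, color1), (color3, color1, color2),
     (color1, color3, color2), (color3, color2, color1), (color2, color1, color3)}"
proof -
  show "\<pi> 0 = 0" by (rule permutes_not_in[OF assms]) simp
  have "\<pi> c \<in> {color1, color2, color3}" if "c \<in> {color1, color2, color3}" for c
    using permutes_in_image[OF assms] that by blast
  then have "\<pi> color1 \<in> {color1, color2, color3}" "\<pi> color2 \<in> {color1, color2, color3}"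
      "\<pi> color3 \<in> {color1, color2, color3}" by simp_all
  moreover have "\<pi> color1 \<noteq> \<pi> color2" "\<pi> color1 \<noteq> \<pi> color3" "\<pi> color2 \<noteq> \<pi> color3"
    using permutes_inj[OF assms] by (simp_all add: inj_eq)
  ultimately show "(\<pi> color1, \<pi> color2, \<pi> color3) \<in>
    {(color1, color2, color3), (color2, color3, color1), (color3, color1, color2),
     (color1, color3, color2), (color3, color2, color1), (color2, color1, color3)}"
    by (elim insertE emptyE; simp)
qed

text \<open>Every permutation of the three nonzero elements is an automorphism of the Klein four-group.\<close>

lemma permutes_colors_add:
  assumes "\<pi> permutes {color1, color2, color3}"
  shows "\<pi> (a + b) = \<pi> a + \<pi> b"
  using permutes_colors[OF assms]
  by (cases a rule: color_cases; cases b rule: color_cases) auto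

text \<open>An even permutation preserves all signs and an odd one reverses all of them. The sign of the
  triple of images of 1, 2, 3 is the parity.\<close>

lemma vertex_sign_permuted:
  assumes "\<pi> permutes {color1, color2, color3}" and "b \<noteq> 0" "c \<noteq> 0" "b + c \<noteq> 0"
  shows "vertex_sign (\<pi> (b + c)) (\<pi> b) (\<pi> c) =
    (if vertex_sign (\<pi> color1) (\<pi> color2) (\<pi> color3) = Plus then vertex_sign (b + c) b c
     else flip (vertex_sign (b + c) b c))"
  using permutes_colors(2)[OF assms(1)] assms(2-)
  by (cases b rule: color_cases; cases c rule: color_cases) (auto simp: vertex_sign_def)

context
  fixes \<pi> :: "color \<Rightarrow> color" and T :: "vertex set" and c :: "color list"
  assumes \<pi>: "\<pi> permutes {color1, color2, color3}" and T: "finite_binary_tree T"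
    and c: "valid_coloring T c"
begin

lemma edge_coloring_permuted:
  assumes "Word u \<in> T"
  shows "edge_coloring T (map \<pi> c) (Word u) = \<pi> (edge_coloring T c (Word u))"
proof (rule edge_coloring_eqI[OF T _ assms])
  have "length c = card (leaves T)" using c by (simp add: valid_coloring_def)
  then show "extends_coloring T (map \<pi> c) (\<lambda>x. \<pi> (edge_coloring T c x))"
    using extends_edge_coloring[OF T, of c] leaf_index_less[OF T]
    by (auto simp: extends_coloring_def permutes_colors_add[OF \<pi>])
qed

lemma valid_coloring_permuted: "valid_coloring T (map \<pi> c)"
proof -
  have "\<pi> a \<noteq> 0" if "a \<noteq> 0" for a
    using inj_eq[OF permutes_inj[OF \<pi>], of a 0] permutes_colors(1)[OF \<pi>] that by simp
  then show ?thesis using c edge_coloring_permuted by (simp add: valid_coloring_iff[OF T])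
qed

lemma derived_signs_permuted:
  assumes "x \<in> internal T"
  shows "derived_signs T (map \<pi> c) x =
    (if vertex_sign (\<pi> color1) (\<pi> color2) (\<pi> color3) = Plus then derived_signs T c x
     else flip (derived_signs T c x))"
proof -
  obtain u where u: "x = Word u" "Word (u @ [False]) \<in> T"
    using assms internal_iff[OF T, of x False] by blast
  have mem: "Word u \<in> T" "Word (u @ [True]) \<in> T"
    using tree_prefix[OF T u(2)] tree_sibling[OF T u(2)] by auto
  let ?a = "edge_coloring T c (Word u)"
  let ?x = "edge_coloring T c (Word (u @ [False]))" and ?y = "edge_coloring T c (Word (u @ [True]))"
  have sum: "?a = ?x + ?y" by (rule edge_coloring_internal[OF T u(2)])
  have "?a \<noteq> 0" "?x \<noteq> 0" "?y \<noteq> 0"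
    using c mem u(2) unfolding valid_coloring_iff[OF T] by blast+
  then have "vertex_sign (\<pi> ?a) (\<pi> ?x) (\<pi> ?y) =
      (if vertex_sign (\<pi> color1) (\<pi> color2) (\<pi> color3) = Plus then vertex_sign ?a ?x ?y
       else flip (vertex_sign ?a ?x ?y))"
    unfolding sum by (intro vertex_sign_permuted[OF \<pi>])
  then show ?thesis
    unfolding u(1) derived_signs_eq[OF T u(2)] edge_coloring_permuted[OF mem(1)]
      edge_coloring_permuted[OF u(2)] edge_coloring_permuted[OF mem(2)] .
qed

end

lemma color_permutation_moving:
  assumes "a \<noteq> 0" "b \<noteq> 0" "a \<noteq> (b :: color)"
  shows "\<exists>\<pi>. \<pi> permutes {color1, color2, color3} \<and> \<pi> a = color1 \<and> \<pi> b = color2"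
proof -
  let ?p = "transpose a color1"
  let ?q = "transpose (?p b) color2"
  have p: "?p permutes {color1, color2, color3}"
    using assms(1) color_nonzero_iff by (intro permutes_swap_id) auto
  have "?p b \<noteq> 0" using assms by (auto simp: transpose_def)
  then have "?q permutes {color1, color2, color3}"
    using color_nonzero_iff by (intro permutes_swap_id) auto
  then have "(?q \<circ> ?p) permutes {color1, color2, color3}"
    using p by (rule permutes_compose[rotated])
  moreover have "(?q \<circ> ?p) a = color1" "(?q \<circ> ?p) b = color2"
    using assms by (auto simp: transpose_def)
  ultimately show ?thesis by blast
qed

lemma equiv_color_permutation_rel: "equiv UNIV color_permutation_rel"
proof (rule equivI)
  let ?S = "{color1, color2, color3}"
  show "refl color_permutation_rel"
    unfolding color_permutation_rel_def
    by (auto intro!: refl_onI exI[of _ id] simp: permutes_id)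
  show "sym color_permutation_rel"
  proof (rule symI)
    fix c c' assume "(c, c') \<in> color_permutation_rel"
    then obtain \<pi> where \<pi>: "\<pi> permutes ?S" "c' = map \<pi> c" by (auto simp: color_permutation_rel_def)
    then have "c = map (inv \<pi>) c'" by (simp add: permutes_inv_o comp_def permutes_inverses)
    then show "(c', c) \<in> color_permutation_rel"
      unfolding color_permutation_rel_def using permutes_inv[OF \<pi>(1)] by blast
  qed
  show "trans color_permutation_rel"
  proof (rule transI)
    fix c c' c'' assume "(c, c') \<in> color_permutation_rel" "(c', c'') \<in> color_permutation_rel"
    then obtain \<pi> \<rho> where "\<pi> permutes ?S" "c' = map \<pi> c" "\<rho> permutes ?S" "c'' = map \<rho> c'"
      by (auto simp: color_permutation_rel_def)
    then have "(\<rho> \<circ> \<pi>) permutes ?S" "c'' = map (\<rho> \<circ> \<pi>) c"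
      by (simp_all add: permutes_compose)
    then show "(c, c'') \<in> color_permutation_rel"
      unfolding color_permutation_rel_def by blast
  qed
qed simp

text \<open>Each orbit of colorings has exactly one member in which the edges at the vertex below the root
  are colored 1, 2, 3 in this order. These members are the colorings with color 1 at the root and the
  sign \<open>Plus\<close> at that vertex, so that their derived signs enumerate them.\<close>

lemma card_color_orbits:
  assumes T: "finite_binary_tree T" and root: "Word [] \<in> internal T"
    and G: "\<forall>(s, t, b) \<in> set G. s \<in> internal T \<and> t \<in> internal T"
  shows "card ({c. valid_coloring T c \<and> compatible (derived_signs T c) G} // color_permutation_rel) =
    card {\<sigma> \<in> sign_assignments T. compatible \<sigma> G \<and> \<sigma> (Word []) = Plus}"
proof -
  define A where "A = {c. valid_coloring T c \<and> compatible (derived_signs T c) G}"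
  define f where "f c u = edge_coloring T c (Word u)" for c u
  define B where "B = {c \<in> A. f c [] = color1 \<and> derived_signs T c (Word []) = Plus}"
  have mem: "Word [] \<in> T" "Word [b] \<in> T" for b
    using root Word_internal_iff[OF T, of "[]" b] by (auto simp: internal_def)
  have nz: "f c [] \<noteq> 0" "f c [b] \<noteq> 0" if "valid_coloring T c" for c b
    using that mem unfolding valid_coloring_iff[OF T] f_def by auto
  have sum: "f c [] = f c [False] + f c [True]" for c
    using edge_coloring_internal[OF T, of "[]" False c] mem by (simp add: f_def)
  have sgn: "derived_signs T c (Word []) = vertex_sign (f c []) (f c [False]) (f c [True])" for c
    using derived_signs_eq[OF T, of "[]" False c] mem by (simp add: f_def)
  \<comment> \<open>The first description of the transversal is made for counting signs, the second for counting
    orbits.\<close>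
  have B_iff: "c \<in> B \<longleftrightarrow> c \<in> A \<and> f c [] = color1 \<and> f c [False] = color2" for c
  proof -
    have "vertex_sign color1 (f c [False]) (f c [True]) = Plus \<longleftrightarrow> f c [False] = color2"
      if "f c [] = color1"
      using that sum[of c]
      by (cases "f c [False]" rule: color_cases; cases "f c [True]" rule: color_cases)
        (simp_all add: vertex_sign_def)
    then show ?thesis unfolding B_def sgn by auto
  qed
  have closed: "map \<pi> c \<in> A" if \<pi>: "\<pi> permutes {color1, color2, color3}" and c: "c \<in> A" for \<pi> c
  proof -
    have v: "valid_coloring T c" using c by (simp add: A_def)
    have "compatible (derived_signs T (map \<pi> c)) G \<longleftrightarrow> compatible (derived_signs T c) G"
    proof (rule compatible_iff_if_same_equalities)
      fix s t b assume "(s, t, b) \<in> set G"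
      then have "s \<in> internal T" "t \<in> internal T" using G by auto
      then show "derived_signs T (map \<pi> c) s = derived_signs T (map \<pi> c) t \<longleftrightarrow>
          derived_signs T c s = derived_signs T c t"
        by (simp add: derived_signs_permuted[OF \<pi> T v])
    qed
    then show ?thesis using c valid_coloring_permuted[OF \<pi> T v] by (simp add: A_def)
  qed
  have f_map: "f (map \<pi> c) [] = \<pi> (f c [])" "f (map \<pi> c) [b] = \<pi> (f c [b])"
    if "\<pi> permutes {color1, color2, color3}" "c \<in> A" for \<pi> c b
    using edge_coloring_permuted[OF that(1) T] that(2) mem by (simp_all add: f_def A_def)
  note eq_class = equiv_class_eq_iff[OF equiv_color_permutation_rel]
  have "bij_betw (\<lambda>c. color_permutation_rel `` {c}) B (A // color_permutation_rel)"
  proof (rule bij_betw_imageI)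
    show "inj_on (\<lambda>c. color_permutation_rel `` {c}) B"
    proof (rule inj_onI)
      fix c c' assume c: "c \<in> B" "c' \<in> B"
        and "color_permutation_rel `` {c} = color_permutation_rel `` {c'}"
      then have "(c, c') \<in> color_permutation_rel" using eq_class by blast
      then obtain \<pi> where \<pi>: "\<pi> permutes {color1, color2, color3}" "c' = map \<pi> c"
        by (auto simp: color_permutation_rel_def)
      have "\<pi> color1 = color1" "\<pi> color2 = color2"
        using c f_map[OF \<pi>(1), of c] \<pi>(2) by (auto simp: B_iff)
      then have "\<pi> a = a" for a
        using permutes_colors[OF \<pi>(1)] by (cases a rule: color_cases) auto
      then show "c = c'" using \<pi>(2) by (simp add: map_idI)
    qed
    show "(\<lambda>c. color_permutation_rel `` {c}) ` B = A // color_permutation_rel"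
    proof
      show "(\<lambda>c. color_permutation_rel `` {c}) ` B \<subseteq> A // color_permutation_rel"
        by (auto simp: B_def intro: quotientI)
      show "A // color_permutation_rel \<subseteq> (\<lambda>c. color_permutation_rel `` {c}) ` B"
      proof
        fix C assume "C \<in> A // color_permutation_rel"
        then obtain c where c: "c \<in> A" "C = color_permutation_rel `` {c}" by (auto elim: quotientE)
        have v: "valid_coloring T c" using c(1) by (simp add: A_def)
        have "f c [] \<noteq> f c [False]"
          using sum[of c] nz(2)[OF v, of True] by auto
        then obtain \<pi> where \<pi>: "\<pi> permutes {color1, color2, color3}"
          "\<pi> (f c []) = color1" "\<pi> (f c [False]) = color2"
          using color_permutation_moving nz[OF v] by metis
        then have "map \<pi> c \<in> B" using c(1) closed f_map by (simp add: B_iff)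
        moreover have "(c, map \<pi> c) \<in> color_permutation_rel"
          using \<pi>(1) by (auto simp: color_permutation_rel_def)
        ultimately show "C \<in> (\<lambda>c. color_permutation_rel `` {c}) ` B"
          using c(2) eq_class by (intro image_eqI[of _ _ "map \<pi> c"]) auto
      qed
    qed
  qed
  then have "card (A // color_permutation_rel) = card B"
    by (simp add: bij_betw_same_card)
  also have "bij_betw (derived_signs T) B
      {\<sigma> \<in> sign_assignments T. compatible \<sigma> G \<and> \<sigma> (Word []) = Plus}"
    using bij_betw_derived_signs[OF T] unfolding B_def A_def f_def bij_betw_def
    by (auto intro: inj_on_subset)
  then have "card B = card {\<sigma> \<in> sign_assignments T. compatible \<sigma> G \<and> \<sigma> (Word []) = Plus}"
    by (rule bij_betw_same_card)
  finally show ?thesis by (simp add: A_def)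
qed

section \<open>Valid paths, sign assignments and colorings\<close>

theorem theorem11p2:
  fixes d :: nat and D :: "vertex set" and w :: "rotation list"
  assumes "D \<in> associahedron_vertices d"
    and "edge_path D w"
  shows "(\<forall>\<sigma> \<in> sign_assignments D. valid_path D \<sigma> w \<longleftrightarrow> compatible \<sigma> (Sigma_graph w)) \<and>
    (balanced (Sigma_graph w) \<longrightarrow>
       card {\<sigma> \<in> sign_assignments D. valid_path D \<sigma> w} =
         2 ^ card (components (internal D) (Sigma_graph w))) \<and>
    (balanced (Sigma_graph w) \<longrightarrow>
       card (compatible_colorings D w // color_permutation_rel) =
         2 ^ (card (components (internal D) (Sigma_graph w)) - 1))"
proof -
  let ?G = "Sigma_graph w"
  let ?p = "card (components (internal D) ?G)"
  have D: "finite_binary_tree D" and "card (leaves D) \<ge> 2"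
    using assms(1) by (simp_all add: associahedron_vertices_def)
  note root = top_vertex_internal[OF this]
  note G = Sigma_graph_in_internal[OF D assms(2)]
  note valid = valid_path_iff_compatible[OF D assms(2)]
  have count: "card {\<sigma> \<in> sign_assignments D. compatible \<sigma> ?G} = 2 ^ ?p" if "balanced ?G"
    unfolding sign_assignments_def
    by (rule card_compatible_assignments[OF finite_internal[OF D] G that])
  have "card (compatible_colorings D w // color_permutation_rel) = 2 ^ (?p - 1)" if bal: "balanced ?G"
  proof -
    have "compatible_colorings D w = {c. valid_coloring D c \<and> compatible (derived_signs D c) ?G}"
      using valid_coloring_path_end[OF D] valid
      by (auto simp: compatible_colorings_def valid_pair_coloring_def)
    then have "2 * card (compatible_colorings D w // color_permutation_rel) = 2 ^ ?p"
      using card_color_orbits[OF D root G] card_compatible_with_Plus[OF finite_internal[OF D] G root]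
        count[OF bal]
      by (simp add: sign_assignments_def)
    then show ?thesis by (cases ?p) auto
  qed
  then show ?thesis using valid count by simp
qed

end
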